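(* Let $M$ be a smooth finite-dimensional manifold and let $\mathbf y=(y,y^\dagger)$ be a pair of continuous functions $y:[0,T]\to M$, $y^\dagger:[0,T]\to L(W,TM)$ with $y_s^\dagger\in L(W,T_{y_s}M)$ for all $s$. Then $\mathbf y\in CRP_{\mathbf X}(M)$ if and only if for every $f\in C^\infty(M)$ (real-valued), $$f_*\mathbf y:=\left(f(y),\,df\circ y^\dagger\right)\in CRP_{\mathbf X}(\mathbb R).$$
   Context: Rough paths. $W=\mathbb R^k$, $T>0$, $1\le p<3$, $\Delta_{[0,T]}=\{(s,t):0\le s\le t\le T\}$. A control is a continuous $\omega:\Delta_{[0,T]}\to[0,\infty)$ with $\omega(s,s)=0$ and $\omega(s,t)+\omega(t,u)\le\omega(s,u)$ for $s\le t\le u$. $\mathbf X=(x,\mathbb X)$ is a fixed weak-geometric $p$-rough path with control $\omega$: $x:[0,T]\to W$ and $\mathbb X:\Delta_{[0,T]}\to W\otimes W$ are continuous and, with $x_{s,t}:=x_t-x_s$, one has $\mathbb X_{s,u}=\mathbb X_{s,t}+\mathbb X_{t,u}+x_{s,t}\otimes x_{t,u}$ for $s\le t\le u$, $|x_{s,t}|\le\omega(s,t)^{1/p}$, $|\mathbb X_{s,t}|\le\omega(s,t)^{2/p}$, and the symmetric part of $\mathbb X_{s,t}$ equals $\frac12x_{s,t}\otimes x_{s,t}$. For a Banach space $V$, $CRP_{\mathbf X}(V)$ is the set of continuous pairs $(z,z^\dagger)$, $z:[0,T]\to V$, $z^\dagger:[0,T]\to L(W,V)$, for which there is $C$ with $|z_t-z_s-z_s^\dagger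 x_{s,t}|\le C\omega(s,t)^{2/p}$ and $|z_t^\dagger-z_s^\dagger|\le C\omega(s,t)^{1/p}$ for all $0\le s\le t\le T$. $CRP_{\mathbf X}(M)$ is the set of continuous pairs $(y,y^\dagger)$ with $y:[0,T]\to M$, $y^\dagger_s\in L(W,T_{y_s}M)$, such that for every chart $\phi$ of $M$ with domain $D(\phi)$ and every $[a,b]\subseteq[0,T]$ with $y([a,b])\subseteq D(\phi)$ there is $C_{\phi,a,b}\ge0$ such that for all $a\le s\le t\le b$: $|\phi(y_t)-\phi(y_s)-d\phi\circ y_s^\dagger x_{s,t}|\le C_{\phi,a,b}\,\omega(s,t)^{2/p}$ and $|d\phi\circ y_t^\dagger-d\phi\circ y_s^\dagger|\le C_{\phi,a,b}\,\omega(s,t)^{1/p}$. (Here $d\phi$ is the $\mathbb R^d$-valued differential, with base points dropped.) *)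

theory Defs
  imports "HOL-Analysis.Analysis"
begin

section \<open>Rough paths and controlled rough paths in Banach spaces\<close>

definition simplex2 :: "real \<Rightarrow> (real \<times> real) set" where
  "simplex2 T = {(s, t). 0 \<le> s \<and> s \<le> t \<and> t \<le> T}"

definition control :: "real \<Rightarrow> (real \<Rightarrow> real \<Rightarrow> real) \<Rightarrow> bool" where
  "control T \<omega> \<longleftrightarrow>
     continuous_on (simplex2 T) (\<lambda>(s, t). \<omega> s t) \<and>
     (\<forall>(s, t) \<in> simplex2 T. 0 \<le> \<omega> s t) \<and>
     (\<forall>s \<in> {0..T}. \<omega> s s = 0) \<and>
     (\<forall>s t u. 0 \<le> s \<and> s \<le> t \<and> t \<le> u \<and> u \<le> T \<longrightarrow> \<omega> s t + \<omega> t u \<le> \<omega> s u)"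

text \<open>
  The space \<open>W \<otimes> W\<close> for \<open>W = real ^ 'k\<close> is the space of \<open>k \<times> k\<close> matrices; its library norm
  is the Hilbert--Schmidt norm.
\<close>

definition tensor :: "real ^ 'k \<Rightarrow> real ^ 'k \<Rightarrow> real ^ 'k ^ 'k" where
  "tensor v w = (\<chi> i j. v $ i * w $ j)"

definition weak_geometric_rough_path ::
  "real \<Rightarrow> real \<Rightarrow> (real \<Rightarrow> real \<Rightarrow> real) \<Rightarrow>
   (real \<Rightarrow> real ^ 'k) \<times> (real \<Rightarrow> real \<Rightarrow> real ^ 'k ^ 'k) \<Rightarrow> bool" where
  "weak_geometric_rough_path T p \<omega> = (\<lambda>(x, XX).
     continuous_on {0..T} x \<and>
     continuous_on (simplex2 T) (\<lambda>(s, t). XX s t) \<and>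
     (\<forall>s t u. 0 \<le> s \<and> s \<le> t \<and> t \<le> u \<and> u \<le> T \<longrightarrow>
        XX s u = XX s t + XX t u + tensor (x t - x s) (x u - x t)) \<and>
     (\<forall>(s, t) \<in> simplex2 T.
        norm (x t - x s) \<le> \<omega> s t powr (1 / p) \<and>
        norm (XX s t) \<le> \<omega> s t powr (2 / p) \<and>
        (1 / 2) *\<^sub>R (XX s t + transpose (XX s t)) = (1 / 2) *\<^sub>R tensor (x t - x s) (x t - x s)))"

text \<open>
  Paths are total functions on \<open>real\<close> of which only the values on \<open>{0..T}\<close> matter.
\<close>

definition CRP ::
  "real \<Rightarrow> real \<Rightarrow> (real \<Rightarrow> real \<Rightarrow> real) \<Rightarrow>
   (real \<Rightarrow> real ^ 'k) \<times> (real \<Rightarrow> real \<Rightarrow> real ^ 'k ^ 'k) \<Rightarrow>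
   ((real \<Rightarrow> 'v::banach) \<times> (real \<Rightarrow> (real ^ 'k) \<Rightarrow>\<^sub>L 'v)) set" where
  "CRP T p \<omega> X = (let x = fst X in
     {(z, z'). continuous_on {0..T} z \<and> continuous_on {0..T} z' \<and>
        (\<exists>C. \<forall>s t. 0 \<le> s \<and> s \<le> t \<and> t \<le> T \<longrightarrow>
           norm (z t - z s - blinfun_apply (z' s) (x t - x s)) \<le> C * \<omega> s t powr (2 / p) \<and>
           norm (z' t - z' s) \<le> C * \<omega> s t powr (1 / p))})"


section \<open>Smooth manifolds\<close>

text \<open>
  \<open>Cn_on n S f\<close> is used for open \<open>S\<close> in finite-dimensional spaces only.  There, continuity of the
  iterated derivatives in each fixed direction is the same as continuity in the operator norm, so
  this is the usual notion of an \<open>n\<close> times continuously differentiable map.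
\<close>

primrec Cn_on ::
  "nat \<Rightarrow> 'a::real_normed_vector set \<Rightarrow> ('a \<Rightarrow> 'b::real_normed_vector) \<Rightarrow> bool" where
  "Cn_on 0 S f \<longleftrightarrow> continuous_on S f"
| "Cn_on (Suc n) S f \<longleftrightarrow>
     (\<forall>x\<in>S. f differentiable (at x)) \<and> (\<forall>v. Cn_on n S (\<lambda>x. frechet_derivative f (at x) v))"

definition smooth_on ::
  "'a::real_normed_vector set \<Rightarrow> ('a \<Rightarrow> 'b::real_normed_vector) \<Rightarrow> bool" where
  "smooth_on S f \<longleftrightarrow> (\<forall>n. Cn_on n S f)"

text \<open>
  A chart is a pair of its domain and its coordinate map; the values of the coordinate map outside
  the domain are irrelevant.
\<close>

type_synonym ('m, 'd) chart = "'m set \<times> ('m \<Rightarrow> real ^ 'd)"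

abbreviation dom_chart :: "('m, 'd::finite) chart \<Rightarrow> 'm set" where
  "dom_chart \<equiv> fst"

abbreviation map_chart :: "('m, 'd::finite) chart \<Rightarrow> 'm \<Rightarrow> real ^ 'd" where
  "map_chart \<equiv> snd"

abbreviation inv_chart :: "('m, 'd::finite) chart \<Rightarrow> real ^ 'd \<Rightarrow> 'm" where
  "inv_chart c \<equiv> inv_into (dom_chart c) (map_chart c)"

definition topological_chart :: "'m topology \<Rightarrow> ('m, 'd::finite) chart \<Rightarrow> bool" where
  "topological_chart M c \<longleftrightarrow>
     openin M (dom_chart c) \<and> open (map_chart c ` dom_chart c) \<and>
     homeomorphic_map (subtopology M (dom_chart c)) (top_of_set (map_chart c ` dom_chart c))
       (map_chart c)"

definition smoothly_compatible :: "('m, 'd::finite) chart \<Rightarrow> ('m, 'd) chart \<Rightarrow> bool" where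
  "smoothly_compatible c c' \<longleftrightarrow>
     smooth_on (map_chart c ` (dom_chart c \<inter> dom_chart c')) (map_chart c' \<circ> inv_chart c) \<and>
     smooth_on (map_chart c' ` (dom_chart c \<inter> dom_chart c')) (map_chart c \<circ> inv_chart c')"

definition second_countable_space :: "'m topology \<Rightarrow> bool" where
  "second_countable_space M \<longleftrightarrow>
     (\<exists>\<B>. countable \<B> \<and> (\<forall>V\<in>\<B>. openin M V) \<and>
        (\<forall>U x. openin M U \<and> x \<in> U \<longrightarrow> (\<exists>V\<in>\<B>. x \<in> V \<and> V \<subseteq> U)))"

text \<open>
  \<open>\<A>\<close> is the maximal smooth atlas, so ``chart of the manifold'' means ``element of \<open>\<A>\<close>''.
\<close>

definition smooth_manifold :: "'m topology \<Rightarrow> ('m, 'd::finite) chart set \<Rightarrow> bool" where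
  "smooth_manifold M \<A> \<longleftrightarrow>
     Hausdorff_space M \<and> second_countable_space M \<and>
     (\<forall>c\<in>\<A>. topological_chart M c) \<and>
     (\<Union>c\<in>\<A>. dom_chart c) = topspace M \<and>
     (\<forall>c\<in>\<A>. \<forall>c'\<in>\<A>. smoothly_compatible c c') \<and>
     (\<forall>c. topological_chart M c \<and> (\<forall>c'\<in>\<A>. smoothly_compatible c c') \<longrightarrow> c \<in> \<A>)"

definition smooth_functions :: "('m, 'd::finite) chart set \<Rightarrow> ('m \<Rightarrow> real) set" where
  "smooth_functions \<A> =
     {f. \<forall>c\<in>\<A>. smooth_on (map_chart c ` dom_chart c) (f \<circ> inv_chart c)}"

text \<open>
  A tangent vector at \<open>p\<close> is an equivalence class of pairs \<open>(c, v)\<close> of a chart at \<open>p\<close> and a vector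
  in \<open>real ^ 'd\<close>, where \<open>(c, v)\<close> and \<open>(c', v')\<close> are equivalent if the derivative of the change of
  coordinates takes \<open>v\<close> to \<open>v'\<close>.  Such a class is the graph of a function on the charts at \<open>p\<close>, and
  it is represented by this function, extended by \<open>0\<close>.  The vector space operations of the
  tangent space are the pointwise ones.
\<close>

type_synonym ('m, 'd) tangent = "('m, 'd) chart \<Rightarrow> real ^ 'd"

definition tangent_space ::
  "('m, 'd::finite) chart set \<Rightarrow> 'm \<Rightarrow> ('m, 'd) tangent set" where
  "tangent_space \<A> p =
     {\<xi>. (\<forall>c\<in>\<A>. \<forall>c'\<in>\<A>. p \<in> dom_chart c \<and> p \<in> dom_chart c' \<longrightarrow>
            \<xi> c' = frechet_derivative (map_chart c' \<circ> inv_chart c) (at (map_chart c p)) (\<xi> c)) \<and>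
         (\<forall>c. \<not> (c \<in> \<A> \<and> p \<in> dom_chart c) \<longrightarrow> \<xi> c = 0)}"

text \<open>
  The differential at \<open>p\<close> of a map that is smooth near \<open>p\<close>, with the base point of its value
  dropped.  By the chain rule it does not depend on the chosen chart.
\<close>

definition differential ::
  "('m, 'd::finite) chart set \<Rightarrow> ('m \<Rightarrow> 'b::real_normed_vector) \<Rightarrow> 'm \<Rightarrow>
   ('m, 'd) tangent \<Rightarrow> 'b" where
  "differential \<A> F p \<xi> =
     (let c = SOME c. c \<in> \<A> \<and> p \<in> dom_chart c
      in frechet_derivative (F \<circ> inv_chart c) (at (map_chart c p)) (\<xi> c))"

lemma differential_map_chart:
  assumes "c \<in> \<A>" "p \<in> dom_chart c" "\<xi> \<in> tangent_space \<A> p"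
  shows "differential \<A> (map_chart c) p \<xi> = \<xi> c"
proof -
  let ?c = "SOME c. c \<in> \<A> \<and> p \<in> dom_chart c"
  have c: "?c \<in> \<A>" "p \<in> dom_chart ?c"
    using someI[of "\<lambda>c. c \<in> \<A> \<and> p \<in> dom_chart c" c] assms(1,2) by blast+
  have "\<forall>c\<in>\<A>. \<forall>c'\<in>\<A>. p \<in> dom_chart c \<and> p \<in> dom_chart c' \<longrightarrow>
          \<xi> c' = frechet_derivative (map_chart c' \<circ> inv_chart c) (at (map_chart c p)) (\<xi> c)"
    using assms(3) unfolding tangent_space_def by blast
  from this[rule_format, OF c(1) assms(1) conjI, OF c(2) assms(2)] show ?thesis
    unfolding differential_def Let_def by (rule sym)
qed


section \<open>The bundle \<open>L(W, TM)\<close>\<close>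

text \<open>
  The fibre \<open>L(W, T\<^sub>p M)\<close> for \<open>W = real ^ 'k\<close>; since the operations of the tangent space are
  pointwise, so is linearity.
\<close>

definition hom_tangent ::
  "('m, 'd::finite) chart set \<Rightarrow> 'm \<Rightarrow> (real ^ 'k \<Rightarrow> ('m, 'd) tangent) set" where
  "hom_tangent \<A> p =
     {A. (\<forall>w. A w \<in> tangent_space \<A> p) \<and> (\<forall>c. linear (\<lambda>w. A w c))}"

text \<open>
  \<open>dF\<^sub>p \<circ> A\<close> as a bounded operator; the argument of \<open>Blinfun\<close> is linear, hence bounded, when
  \<open>A \<in> L(W, T\<^sub>p M)\<close> and \<open>F\<close> is smooth near \<open>p\<close>.
\<close>

definition differential_comp ::
  "('m, 'd::finite) chart set \<Rightarrow> ('m \<Rightarrow> 'b::real_normed_vector) \<Rightarrow> 'm \<Rightarrow>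
   (real ^ 'k \<Rightarrow> ('m, 'd) tangent) \<Rightarrow> (real ^ 'k) \<Rightarrow>\<^sub>L 'b" where
  "differential_comp \<A> F p A = Blinfun (\<lambda>w. differential \<A> F p (A w))"

text \<open>
  The total space of \<open>L(W, TM)\<close> consists of the pairs \<open>(p, A)\<close> with \<open>A \<in> L(W, T\<^sub>p M)\<close>.  Its topology
  is generated by the preimages of open sets under the local trivialisations
  \<open>(p, A) \<mapsto> (\<phi> p, d\<phi> \<circ> A)\<close>.
\<close>

definition hom_bundle ::
  "('m, 'd::finite) chart set \<Rightarrow> ('m \<times> (real ^ 'k \<Rightarrow> ('m, 'd) tangent)) topology" where
  "hom_bundle \<A> = topology_generated_by
     {{(p, A). p \<in> dom_chart c \<and> A \<in> hom_tangent \<A> p \<and>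
               (map_chart c p, differential_comp \<A> (map_chart c) p A) \<in> V} | c V.
        c \<in> \<A> \<and> open V}"


section \<open>Controlled rough paths in manifolds\<close>

definition continuous_manifold_pair ::
  "real \<Rightarrow> 'm topology \<Rightarrow> ('m, 'd::finite) chart set \<Rightarrow>
   (real \<Rightarrow> 'm) \<times> (real \<Rightarrow> real ^ 'k \<Rightarrow> ('m, 'd) tangent) \<Rightarrow> bool" where
  "continuous_manifold_pair T M \<A> = (\<lambda>(y, y').
     continuous_map (top_of_set {0..T}) M y \<and>
     continuous_map (top_of_set {0..T}) (hom_bundle \<A>) (\<lambda>s. (y s, y' s)) \<and>
     (\<forall>s\<in>{0..T}. y' s \<in> hom_tangent \<A> (y s)))"

definition CRP_manifold ::
  "real \<Rightarrow> real \<Rightarrow> (real \<Rightarrow> real \<Rightarrow> real) \<Rightarrow>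
   (real \<Rightarrow> real ^ 'k) \<times> (real \<Rightarrow> real \<Rightarrow> real ^ 'k ^ 'k) \<Rightarrow>
   'm topology \<Rightarrow> ('m, 'd::finite) chart set \<Rightarrow>
   ((real \<Rightarrow> 'm) \<times> (real \<Rightarrow> real ^ 'k \<Rightarrow> ('m, 'd) tangent)) set" where
  "CRP_manifold T p \<omega> X M \<A> = (let x = fst X in
     {(y, y'). continuous_manifold_pair T M \<A> (y, y') \<and>
        (\<forall>c\<in>\<A>. \<forall>a b. 0 \<le> a \<and> a \<le> b \<and> b \<le> T \<and> y ` {a..b} \<subseteq> dom_chart c \<longrightarrow>
           (let \<phi> = map_chart c; d\<phi>y' = (\<lambda>s. differential_comp \<A> \<phi> (y s) (y' s)) in
            \<exists>C\<ge>0. \<forall>s t. a \<le> s \<and> s \<le> t \<and> t \<le> b \<longrightarrow>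
              norm (\<phi> (y t) - \<phi> (y s) - blinfun_apply (d\<phi>y' s) (x t - x s))
                \<le> C * \<omega> s t powr (2 / p) \<and>
              norm (d\<phi>y' t - d\<phi>y' s) \<le> C * \<omega> s t powr (1 / p)))})"

definition push_forward ::
  "('m, 'd::finite) chart set \<Rightarrow> ('m \<Rightarrow> real) \<Rightarrow>
   (real \<Rightarrow> 'm) \<times> (real \<Rightarrow> real ^ 'k \<Rightarrow> ('m, 'd) tangent) \<Rightarrow>
   (real \<Rightarrow> real) \<times> (real \<Rightarrow> (real ^ 'k) \<Rightarrow>\<^sub>L real)" where
  "push_forward \<A> f = (\<lambda>(y, y').
     (\<lambda>s. f (y s), \<lambda>s. differential_comp \<A> f (y s) (y' s)))"

end

theory Submission
  imports Defs
begin

text \<open>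
  In a chart both conditions are local: \<open>\<omega>\<close> is superadditive, so the estimates on two adjacent
  intervals combine (the defect of the first-order expansion across the common endpoint is
  \<open>(z'\<^sub>m - z'\<^sub>s) x\<^sub>m\<^sub>,\<^sub>t\<close>, which is of order \<open>\<omega>(s,t)\<^bsup>2/p\<^esup>\<close>), and by compactness local estimates
  give global ones.  A smooth function of a controlled path is controlled by Taylor's formula of
  second order.  Conversely, multiplying the coordinates of a chart by a cutoff function gives
  globally defined smooth functions which agree with the coordinates near a given point.
\<close>

subsection \<open>Calculus of smooth maps\<close>

text \<open>Taylor's formula is applied on compact convex sets, and the image of a chart need not be
  convex; so even a path that stays in one chart is cut into short pieces, each lying in a closed
  coordinate ball. Likewise each cutoff used equals 1 only near one point, so the coordinates are
  recovered from global functions for short times only. Both directions therefore end in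
  \<open>controlled_local_imp\<close>. All estimates are phrased with
  \<open>w = \<omega> powr (1 / p)\<close>: the two orders become \<open>w\<close> and its square,
  and a product of two first-order quantities is of second order. Superadditivity need not survive
  the power, but gluing uses monotonicity, which does. \<open>Cn_on\<close> controls derivatives in
  fixed directions; wherever the direction varies with the point, as in the chain rule, the
  derivative is expanded over the basis.\<close>

lemma Cn_on_cong:
  assumes "open S" and "\<And>x. x \<in> S \<Longrightarrow> f x = g x" and "Cn_on n S f"
  shows "Cn_on n S g"
  using assms(2,3)
proof (induction n arbitrary: f g)
  case 0
  then show ?case by (auto cong: continuous_on_cong_simp)
next
  case (Suc n)
  have diff: "f differentiable (at x)" if "x \<in> S" for x using Suc.prems that by simp
  have "g differentiable (at x)" if x: "x \<in> S" for x
    using diff[OF x] has_derivative_transform_within_open[of f _ x UNIV S g, OF _ assms(1) x] Suc.prems(1)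
    unfolding differentiable_def by blast
  moreover have "frechet_derivative f (at x) = frechet_derivative g (at x)" if x: "x \<in> S" for x
    using frechet_derivative_transform_within_open[OF diff[OF x] assms(1) x Suc.prems(1)] .
  then have "Cn_on n S (\<lambda>x. frechet_derivative g (at x) v)" for v
    using Suc.IH[of "\<lambda>x. frechet_derivative f (at x) v" "\<lambda>x. frechet_derivative g (at x) v"] Suc.prems by simp
  ultimately show ?case by simp
qed

text \<open>\<open>frechet_derivative\<close> is a choice operator; uniqueness of the derivative
  lets any explicit formula \<open>f'\<close> be used in its place.\<close>

lemma Cn_on_SucI:
  assumes "open S" and der: "\<And>x. x \<in> S \<Longrightarrow> (f has_derivative f' x) (at x)"
    and "\<And>v. Cn_on n S (\<lambda>x. f' x v)"
  shows "Cn_on (Suc n) S f"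
proof -
  have "f' x v = frechet_derivative f (at x) v" if "x \<in> S" for x v
    using fun_cong[OF frechet_derivative_at[OF der[OF that]]] .
  then have "Cn_on n S (\<lambda>x. frechet_derivative f (at x) v)" for v
    by (rule Cn_on_cong[OF assms(1) _ assms(3)[of v]])
  moreover have "f differentiable (at x)" if "x \<in> S" for x
    using der[OF that] by (rule differentiableI)
  ultimately show ?thesis by simp
qed

lemma Cn_on_SucD:
  assumes "Cn_on (Suc n) S f"
  shows "x \<in> S \<Longrightarrow> (f has_derivative frechet_derivative f (at x)) (at x)"
    and "Cn_on n S (\<lambda>x. frechet_derivative f (at x) v)"
  using assms by (auto simp: frechet_derivative_works)

lemma Cn_on_Suc_imp: "Cn_on (Suc n) S f \<Longrightarrow> Cn_on n S f"
proof (induction n arbitrary: f)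
  case 0
  have "continuous (at x) f" if "x \<in> S" for x
    using 0 that by (intro differentiable_imp_continuous_within) simp
  then show ?case by (simp add: continuous_at_imp_continuous_on)
next
  case (Suc n)
  have "f differentiable (at x)" if "x \<in> S" for x
    using Cn_on_SucD(1)[OF Suc.prems that] by (rule differentiableI)
  with Suc.IH[OF Cn_on_SucD(2)[OF Suc.prems]] show ?case
    unfolding Cn_on.simps(2)[of n] by blast
qed

lemma Cn_on_imp_continuous_on: "Cn_on n S f \<Longrightarrow> continuous_on S f"
proof (induction n)
  case (Suc n)
  show ?case using Suc.IH[OF Cn_on_Suc_imp[OF Suc.prems]] .
qed simp

text \<open>Differentiability at a point is already local; openness serves the base case, where
  continuity on two open sets passes to their union.\<close>

lemma Cn_on_Un:
  assumes "open S" "open S'" "Cn_on n S f" "Cn_on n S' f"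
  shows "Cn_on n (S \<union> S') f"
  using assms(3,4)
  by (induction n arbitrary: f) (auto simp: assms continuous_on_open_Un)

lemma Cn_on_const: "Cn_on n S (\<lambda>x. k)"
  by (induction n arbitrary: k) (auto simp: frechet_derivative_const)

lemma Cn_on_bounded_linear:
  assumes "bounded_linear f" and "open S"
  shows "Cn_on n S f"
proof (cases n)
  case 0
  then show ?thesis using linear_continuous_on[OF assms(1)] by simp
next
  case (Suc m)
  show ?thesis
    unfolding Suc
    by (rule Cn_on_SucI[OF assms(2) bounded_linear_imp_has_derivative[OF assms(1)] Cn_on_const])
qed

lemma Cn_on_add:
  assumes "open S" and "Cn_on n S f" and "Cn_on n S g"
  shows "Cn_on n S (\<lambda>x. f x + g x)"
  using assms(2,3)
proof (induction n arbitrary: f g)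
  case 0
  then show ?case by (auto intro: continuous_on_add)
next
  case (Suc n)
  show ?case
    by (rule Cn_on_SucI[OF assms(1) has_derivative_add[OF Cn_on_SucD(1)[OF Suc.prems(1)] Cn_on_SucD(1)[OF Suc.prems(2)]]])
      (assumption+, intro Suc.IH Suc.prems[THEN Cn_on_SucD(2)])
qed

lemma Cn_on_sum:
  assumes "open S" and "\<And>i. i \<in> I \<Longrightarrow> Cn_on n S (f i)"
  shows "Cn_on n S (\<lambda>x. \<Sum>i\<in>I. f i x)"
  using assms(2)
  by (induction I rule: infinite_finite_induct) (auto intro: Cn_on_const Cn_on_add assms(1))

text \<open>The product rule gives two products, each of an undifferentiated factor and a
  derivative, both of order \<open>n\<close>; hence the induction varies both factors.\<close>

lemma (in bounded_bilinear) Cn_on: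
  assumes "open S" and "Cn_on n S f" and "Cn_on n S g"
  shows "Cn_on n S (\<lambda>x. prod (f x) (g x))"
  using assms(2,3)
proof (induction n arbitrary: f g)
  case 0
  then show ?case by (auto intro: continuous_on)
next
  case (Suc n)
  show ?case
    by (rule Cn_on_SucI[OF assms(1) FDERIV[OF Cn_on_SucD(1)[OF Suc.prems(1)] Cn_on_SucD(1)[OF Suc.prems(2)]]])
      (assumption+, intro Cn_on_add assms(1) Suc.IH Suc.prems[THEN Cn_on_Suc_imp]
        Suc.prems[THEN Cn_on_SucD(2)])
qed

text \<open>Reduces a direction that depends on the point to fixed directions \<open>b\<close>:
  \<open>Cn_on\<close> describes how a derivative varies only while its direction is held
  fixed.\<close>

lemma linear_euclidean_sum:
  fixes D :: "'a::euclidean_space \<Rightarrow> 'b::real_vector"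
  assumes "linear D"
  shows "D v = (\<Sum>b\<in>Basis. (v \<bullet> b) *\<^sub>R D b)"
  using linear_sum[OF assms, of "\<lambda>b. (v \<bullet> b) *\<^sub>R b" Basis]
  by (simp add: euclidean_representation linear_scale[OF assms])

lemma Cn_on_compose:
  fixes g :: "'b::euclidean_space \<Rightarrow> 'c::real_normed_vector"
  assumes "open S" and "Cn_on n S f" and "Cn_on n V g" and sub: "f ` S \<subseteq> V"
  shows "Cn_on n S (\<lambda>x. g (f x))"
  using assms(2,3)
proof (induction n arbitrary: g)
  case 0
  then show ?case using continuous_on_compose2[OF _ _ sub, of g] by simp
next
  case (Suc n)
  let ?f = "\<lambda>x. frechet_derivative f (at x)" and ?g = "\<lambda>x. frechet_derivative g (at x)"
  have der: "((\<lambda>x. g (f x)) has_derivative (\<lambda>v. ?g (f x) (?f x v))) (at x)" if "x \<in> S" for x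
    by (rule has_derivative_compose)
      (use sub that in \<open>auto intro!: Cn_on_SucD[OF Suc.prems(1)] Cn_on_SucD[OF Suc.prems(2)]\<close>)
  \<comment> \<open>The chain-rule derivative in coordinates. The partial derivatives of
    \<open>g\<close> composed with \<open>f\<close> fall under the induction hypothesis, which is
    why \<open>g\<close> is arbitrary in it.\<close>
  have "Cn_on n S (\<lambda>x. \<Sum>b\<in>Basis. (?f x v \<bullet> b) *\<^sub>R ?g (f x) b)" for v
    by (intro Cn_on_sum assms(1) bounded_bilinear.Cn_on[OF bounded_bilinear_scaleR]
        bounded_bilinear.Cn_on[OF bounded_bilinear_inner] Cn_on_const Cn_on_SucD(2)[OF Suc.prems(1)]
        Suc.IH[OF Cn_on_Suc_imp[OF Suc.prems(1)] Cn_on_SucD(2)[OF Suc.prems(2)]])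
  then have "Cn_on n S (\<lambda>x. ?g (f x) (?f x v))" for v
  proof (rule Cn_on_cong[OF assms(1), rotated])
    fix x assume "x \<in> S"
    then have "linear (?g (f x))"
      using sub Cn_on_SucD(1)[OF Suc.prems(2), THEN has_derivative_linear] by blast
    then show "(\<Sum>b\<in>Basis. (?f x v \<bullet> b) *\<^sub>R ?g (f x) b) = ?g (f x) (?f x v)"
      by (simp add: linear_euclidean_sum[of "?g (f x)" "?f x v"])
  qed
  with der show ?case by (rule Cn_on_SucI[OF assms(1)])
qed

subsection \<open>Cutoff functions\<close>

text \<open>The family is closed under differentiation up to linear combinations.\<close>

definition flat_exp :: "nat \<Rightarrow> real \<Rightarrow> real" where
  "flat_exp k t = (if t \<le> 0 then 0 else exp (- inverse t) * inverse t ^ k)"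

text \<open>With \<open>u = 1 / t\<close> the right-hand limit is that of
  \<open>u ^ k / exp u\<close> at infinity.\<close>

lemma flat_exp_tendsto_0: "(flat_exp k \<longlongrightarrow> 0) (at 0)"
proof (rule filterlim_split_at)
  show "(flat_exp k \<longlongrightarrow> 0) (at_left 0)"
    by (rule tendsto_eventually)
      (auto simp: flat_exp_def eventually_at_filter)
  have "((\<lambda>t. inverse t ^ k / exp (inverse t)) \<longlongrightarrow> (0::real)) (at_right 0)"
    by (rule filterlim_compose[OF tendsto_power_div_exp_0 filterlim_inverse_at_top_right])
  then show "(flat_exp k \<longlongrightarrow> 0) (at_right 0)"
    by (rule Lim_transform_eventually)
      (auto simp: flat_exp_def eventually_at_filter exp_minus divide_inverse mult.commute)
qed

lemma flat_exp_DERIV: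
  "(flat_exp k has_field_derivative flat_exp (k + 2) t - real k * flat_exp (k + 1) t) (at t)"
proof -
  consider "t < 0" | "t = 0" | "t > 0" by linarith
  then show ?thesis
  proof cases
    case 1
    have "((\<lambda>_. 0) has_field_derivative 0) (at t)" by simp
    then have "(flat_exp k has_field_derivative 0) (at t)"
      by (rule has_field_derivative_transform_within_open[of _ _ _ "{..<0}"])
        (use 1 in \<open>auto simp: flat_exp_def\<close>)
    then show ?thesis using 1 by (simp add: flat_exp_def)
  next
    case 2
    \<comment> \<open>The difference quotient of \<open>flat_exp k\<close> at 0 is
      \<open>flat_exp (Suc k)\<close>.\<close>
    have "((\<lambda>h. (flat_exp k (0 + h) - flat_exp k 0) / h) \<longlongrightarrow> 0) (at 0)"
      by (rule Lim_transform_eventually[OF flat_exp_tendsto_0[of "Suc k"]])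
        (auto simp: flat_exp_def divide_inverse)
    then show ?thesis using 2 by (simp add: DERIV_def flat_exp_def)
  next
    case 3
    have "((\<lambda>t. exp (- inverse t) * inverse t ^ k) has_field_derivative
        exp (- inverse t) * (inverse t)\<^sup>2 * inverse t ^ k
        - exp (- inverse t) * (real k * inverse t ^ (k - 1) * (inverse t)\<^sup>2)) (at t)"
      by (rule derivative_eq_intros refl | use 3 in \<open>simp add: power2_eq_square algebra_simps\<close>)+
    also have "exp (- inverse t) * (inverse t)\<^sup>2 * inverse t ^ k
        - exp (- inverse t) * (real k * inverse t ^ (k - 1) * (inverse t)\<^sup>2)
        = flat_exp (k + 2) t - real k * flat_exp (k + 1) t"
      \<comment> \<open>The split on \<open>k\<close> settles the truncated \<open>k - 1\<close>: at
        \<open>k = 0\<close> its term carries the factor \<open>real k = 0\<close>.\<close>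
      using 3 by (cases k) (simp_all add: flat_exp_def power2_eq_square algebra_simps)
    finally have "((\<lambda>t. exp (- inverse t) * inverse t ^ k) has_field_derivative
        flat_exp (k + 2) t - real k * flat_exp (k + 1) t) (at t)" .
    then show ?thesis
      by (rule has_field_derivative_transform_within_open[of _ _ _ "{0<..}"])
        (use 3 in \<open>auto simp: flat_exp_def\<close>)
  qed
qed

lemma Cn_on_flat_exp: "Cn_on n UNIV (flat_exp k)"
proof (induction n arbitrary: k)
  case 0
  show ?case using flat_exp_DERIV
    by (auto intro!: continuous_at_imp_continuous_on DERIV_isCont)
next
  case (Suc n)
  have "Cn_on n UNIV (\<lambda>t. (flat_exp (k + 2) t + (- real k) * flat_exp (k + 1) t) * v)" for v
    by (intro bounded_bilinear.Cn_on[OF bounded_bilinear_mult] Cn_on_add Cn_on_const Suc open_UNIV)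
  then show ?case
    by (intro Cn_on_SucI[OF open_UNIV flat_exp_DERIV[unfolded has_field_derivative_def]]) simp
qed

text \<open>Built from the squared distance \<open>q\<close> to \<open>u\<close>, which is smooth at
  \<open>u\<close> too. The rescaled \<open>(q v - r^2) / r^2\<close> is negative inside the ball of
  radius \<open>r\<close> and at least 3 outside the ball of radius \<open>2 * r\<close>, so the
  whole transition from 1 to 0 takes place between the two.\<close>

lemma exists_smooth_cutoff:
  fixes u :: "'a::euclidean_space"
  assumes "0 < r"
  obtains \<psi> :: "'a \<Rightarrow> real" where "smooth_on UNIV \<psi>"
    and "\<And>v. v \<in> ball u r \<Longrightarrow> \<psi> v = 1" and "\<And>v. v \<notin> ball u (2 * r) \<Longrightarrow> \<psi> v = 0"
proof
  define e where "e = flat_exp 0"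
  define q where "q v = (v - u) \<bullet> (v - u)" for v
  \<comment> \<open>The inner \<open>e\<close> is at least \<open>e 1\<close> from \<open>1\<close> on and \<open>0\<close> on the negative half-line; nesting
    replaces the usual quotient, so only compositions of smooth functions are needed.\<close>
  define \<psi> where "\<psi> v = inverse (e (e 1)) * e (e 1 - e ((q v - r^2) * inverse (r^2)))" for v
  have e_pos: "e t > 0" if "t > 0" for t using that by (simp add: e_def flat_exp_def)
  have e_0: "e t = 0" if "t \<le> 0" for t using that by (simp add: e_def flat_exp_def)
  have e_mono: "e 1 \<le> e t" if "1 \<le> t" for t
    using that le_imp_inverse_le[of 1 t] by (simp add: e_def flat_exp_def)
  have q: "q v = dist u v ^ 2" for v
    by (metis q_def dist_commute dist_norm power2_norm_eq_inner)
  have e: "Cn_on n UNIV e" for n by (simp add: e_def Cn_on_flat_exp)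
  have minus: "Cn_on n UNIV (\<lambda>v. f v - g v)" if "Cn_on n UNIV f" "Cn_on n UNIV g"
    for n and f g :: "'a \<Rightarrow> 'x::real_normed_vector"
    using Cn_on_add[OF open_UNIV that(1) bounded_bilinear.Cn_on[OF bounded_bilinear_scaleR open_UNIV
          Cn_on_const[of _ _ "-1"] that(2)]] by simp
  have id: "Cn_on n UNIV (\<lambda>v::'a. v)" for n
    by (rule Cn_on_bounded_linear) auto
  have "Cn_on n UNIV \<psi>" for n
    unfolding \<psi>_def q_def
    by (intro bounded_bilinear.Cn_on[OF bounded_bilinear_mult] Cn_on_const open_UNIV
        Cn_on_compose[OF open_UNIV _ e] minus subset_UNIV id
        bounded_bilinear.Cn_on[OF bounded_bilinear_inner])
  then show "smooth_on UNIV \<psi>" by (simp add: smooth_on_def)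
  show "\<psi> v = 1" if "v \<in> ball u r" for v
  proof -
    have "q v < r^2" unfolding q using that by (intro power_strict_mono) auto
    then have "e ((q v - r^2) * inverse (r^2)) = 0"
      by (intro e_0) (auto simp: mult_le_0_iff)
    moreover have "e (e 1) \<noteq> 0" using e_pos[OF e_pos, of 1] by simp
    ultimately show ?thesis by (simp add: \<psi>_def)
  qed
  show "\<psi> v = 0" if "v \<notin> ball u (2 * r)" for v
  proof -
    have "(2*r)^2 \<le> q v" unfolding q using that assms by (intro power_mono) auto
    then have "4 * r^2 \<le> q v" by (simp add: power_mult_distrib)
    moreover have "0 \<le> r^2" by simp
    ultimately have "r^2 \<le> q v - r^2" by linarith
    then have "1 \<le> (q v - r^2) * inverse (r^2)" using assms by (simp add: field_simps)
    then have "e (e 1 - e ((q v - r^2) * inverse (r^2))) = 0"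
      by (intro e_0) (use e_mono in auto)
    then show ?thesis by (simp add: \<psi>_def)
  qed
qed

subsection \<open>Taylor estimates on compact convex sets\<close>

text \<open>Compactness bounds each partial derivative, the sum of these bounds controls the
  derivative in every direction, and convexity turns this into a Lipschitz bound by the mean value
  inequality.\<close>

lemma C1_bounds:
  fixes h :: "'a::euclidean_space \<Rightarrow> 'b::real_normed_vector"
  assumes "Cn_on 1 U h" "compact B" "convex B" "B \<subseteq> U"
  obtains K where "0 \<le> K" "\<And>x v. x \<in> B \<Longrightarrow> norm (frechet_derivative h (at x) v) \<le> K * norm v"
    "\<And>x y. x \<in> B \<Longrightarrow> y \<in> B \<Longrightarrow> norm (h y - h x) \<le> K * norm (y - x)"
proof -
  let ?D = "\<lambda>x. frechet_derivative h (at x)"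
  have C: "Cn_on (Suc 0) U h" using assms(1) by simp
  have "\<exists>k. \<forall>x\<in>B. norm (?D x b) \<le> k" for b
  proof -
    have "compact ((\<lambda>x. ?D x b) ` B)"
      using C assms by (intro compact_continuous_image) (auto intro: continuous_on_subset)
    then show ?thesis by (auto dest!: compact_imp_bounded simp: bounded_iff)
  qed
  then obtain k where k: "\<And>b x. x \<in> B \<Longrightarrow> norm (?D x b) \<le> k b" by metis
  \<comment> \<open>The absolute values are for an empty \<open>B\<close>, where the chosen bounds
    \<open>k b\<close> may be negative.\<close>
  define K where "K = (\<Sum>b\<in>(Basis::'a set). \<bar>k b\<bar>)"
  have K: "norm (?D x v) \<le> K * norm v" if x: "x \<in> B" for x v
  proof -
    have "linear (?D x)"
      using x assms(4) Cn_on_SucD(1)[OF C, THEN has_derivative_linear] by blast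
    then have "norm (?D x v) = norm (\<Sum>b\<in>Basis. (v \<bullet> b) *\<^sub>R ?D x b)"
      by (simp add: linear_euclidean_sum[of "?D x" v])
    also have "\<dots> \<le> (\<Sum>b\<in>Basis. \<bar>k b\<bar> * norm v)"
    proof (rule order_trans[OF norm_sum sum_mono])
      fix b :: 'a assume "b \<in> Basis"
      then have "\<bar>v \<bullet> b\<bar> \<le> norm v" by (rule Basis_le_norm)
      moreover have "norm (?D x b) \<le> \<bar>k b\<bar>" using k[OF x, of b] by linarith
      ultimately show "norm ((v \<bullet> b) *\<^sub>R ?D x b) \<le> \<bar>k b\<bar> * norm v"
        by (simp add: mult.commute[of "\<bar>k b\<bar>"] mult_mono)
    qed
    finally show ?thesis by (simp add: K_def sum_distrib_right)
  qed
  show thesis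
  proof
    show "0 \<le> K" by (simp add: K_def sum_nonneg)
    show "norm (?D x v) \<le> K * norm v" if "x \<in> B" for x v using K[OF that] .
    show "norm (h y - h x) \<le> K * norm (y - x)" if "x \<in> B" "y \<in> B" for x y
    proof (rule differentiable_bound[OF assms(3) _ _ that(2,1)])
      show "(h has_derivative ?D x) (at x within B)" if "x \<in> B" for x
        using Cn_on_SucD(1)[OF C] that assms(4) by (blast intro: has_derivative_at_withinI)
      show "onorm (?D x) \<le> K" if "x \<in> B" for x
        by (rule onorm_bound[OF _ K[OF that]]) (simp add: K_def sum_nonneg)
    qed
  qed
qed

text \<open>\<open>C1_bounds\<close> for the partial derivatives makes the derivative Lipschitz; the
  mean value inequality for \<open>g\<close> minus its linearization, on the segment from
  \<open>x\<close> to \<open>y\<close>, then bounds the Taylor remainder. The factor 1/2 of Taylor's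
  formula is given up.\<close>

lemma C2_bounds:
  fixes g :: "'a::euclidean_space \<Rightarrow> 'b::real_normed_vector"
  assumes "Cn_on 2 U g" "compact B" "convex B" "B \<subseteq> U"
  obtains K where "0 \<le> K" "\<And>x v. x \<in> B \<Longrightarrow> norm (frechet_derivative g (at x) v) \<le> K * norm v"
    "\<And>x y v. x \<in> B \<Longrightarrow> y \<in> B \<Longrightarrow>
       norm (frechet_derivative g (at y) v - frechet_derivative g (at x) v) \<le> K * norm (y - x) * norm v"
    "\<And>x y. x \<in> B \<Longrightarrow> y \<in> B \<Longrightarrow>
       norm (g y - g x - frechet_derivative g (at x) (y - x)) \<le> K * (norm (y - x))\<^sup>2"
proof -
  let ?D = "\<lambda>x. frechet_derivative g (at x)"
  have C: "Cn_on (Suc (Suc 0)) U g" using assms(1) by (simp add: numeral_2_eq_2)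
  obtain K0 where K0: "0 \<le> K0" "\<And>x v. x \<in> B \<Longrightarrow> norm (?D x v) \<le> K0 * norm v"
    using C1_bounds[OF _ assms(2-4), of g] Cn_on_Suc_imp[OF C] by (metis One_nat_def)
  have "\<exists>k\<ge>0. \<forall>x\<in>B. \<forall>y\<in>B. norm (?D y b - ?D x b) \<le> k * norm (y - x)" for b
    using C1_bounds[OF _ assms(2-4), of "\<lambda>x. ?D x b"] Cn_on_SucD(2)[OF C, of b] by (metis One_nat_def)
  then obtain k where k: "\<And>b. 0 \<le> k b"
    "\<And>b x y. x \<in> B \<Longrightarrow> y \<in> B \<Longrightarrow> norm (?D y b - ?D x b) \<le> k b * norm (y - x)" by metis
  define K1 where "K1 = (\<Sum>b\<in>(Basis::'a set). k b)"
  have K1_pos: "0 \<le> K1" by (simp add: K1_def sum_nonneg k)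
  have lin: "linear (?D x)" if "x \<in> B" for x
    using that assms(4) Cn_on_SucD(1)[OF C, THEN has_derivative_linear] by blast
  have K1: "norm (?D y v - ?D x v) \<le> K1 * norm (y - x) * norm v" if x: "x \<in> B" and y: "y \<in> B" for x y v
  proof -
    have "norm (?D y v - ?D x v) = norm (\<Sum>b\<in>Basis. (v \<bullet> b) *\<^sub>R (?D y b - ?D x b))"
      by (simp add: linear_euclidean_sum[OF lin[OF x], of v] linear_euclidean_sum[OF lin[OF y], of v]
          sum_subtractf scaleR_diff_right)
    also have "\<dots> \<le> (\<Sum>b\<in>Basis. norm v * (k b * norm (y - x)))"
    proof (rule order_trans[OF norm_sum sum_mono])
      fix b :: 'a assume "b \<in> Basis"
      then have "\<bar>v \<bullet> b\<bar> \<le> norm v" by (rule Basis_le_norm)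
      then show "norm ((v \<bullet> b) *\<^sub>R (?D y b - ?D x b)) \<le> norm v * (k b * norm (y - x))"
        using k(2)[OF x y, of b] by (simp add: mult_mono)
    qed
    finally show ?thesis by (simp add: K1_def sum_distrib_right sum_distrib_left mult_ac)
  qed
  have T: "norm (g y - g x - ?D x (y - x)) \<le> K1 * (norm (y - x))\<^sup>2" if x: "x \<in> B" and y: "y \<in> B" for x y
  proof -
    have S: "closed_segment x y \<subseteq> B" using x y assms(3) by (simp add: closed_segment_subset)
    have "norm (g y - g x - ?D x (y - x)) \<le> norm (y - x) * (K1 * norm (y - x))"
    proof (rule differentiable_bound_linearization[where S = "closed_segment x y"])
      show "x + t *\<^sub>R (y - x) \<in> closed_segment x y" if "t \<in> {0..1}" for t
        using that by (auto simp: in_segment algebra_simps intro!: exI[of _ t])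
      show "(g has_derivative ?D z) (at z within closed_segment x y)" if "z \<in> closed_segment x y" for z
        using Cn_on_SucD(1)[OF C] that S assms(4) by (blast intro: has_derivative_at_withinI)
      show "onorm (?D z - ?D x) \<le> K1 * norm (y - x)" if z: "z \<in> closed_segment x y" for z
        unfolding fun_diff_def
      proof (rule onorm_bound)
        show "0 \<le> K1 * norm (y - x)" using K1_pos by simp
        fix v :: 'a
        have "norm (z - x) \<le> norm (y - x)" using segment_bound(1)[OF z] by (simp add: norm_minus_commute)
        then have "K1 * norm (z - x) * norm v \<le> K1 * norm (y - x) * norm v"
          using K1_pos by (intro mult_right_mono mult_left_mono) auto
        then show "norm (?D z v - ?D x v) \<le> K1 * norm (y - x) * norm v"
          using K1[OF x, of z v] z S by fastforce
      qed
    qed simp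
    then show ?thesis by (simp add: power2_eq_square mult_ac)
  qed
  show thesis
  proof (rule that[of "K0 + K1"])
    show "0 \<le> K0 + K1" using K0(1) K1_pos by simp
    show "norm (?D x v) \<le> (K0 + K1) * norm v" if "x \<in> B" for x v
      using K0(2)[OF that, of v] mult_nonneg_nonneg[OF K1_pos norm_ge_zero[of v]]
      by (simp add: distrib_right)
    show "norm (?D y v - ?D x v) \<le> (K0 + K1) * norm (y - x) * norm v" if "x \<in> B" "y \<in> B" for x y v
      using K1[OF that, of v] mult_nonneg_nonneg[OF mult_nonneg_nonneg[OF K0(1) norm_ge_zero[of "y - x"]] norm_ge_zero[of v]]
      by (simp add: distrib_right)
    show "norm (g y - g x - ?D x (y - x)) \<le> (K0 + K1) * (norm (y - x))\<^sup>2" if "x \<in> B" "y \<in> B" for x y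
      using T[OF that] mult_nonneg_nonneg[OF K0(1) zero_le_power2[of "norm (y - x)"]]
      by (simp add: distrib_right)
  qed
qed

subsection \<open>Controlled paths in normed spaces\<close>

text \<open>\<open>w\<close> abstracts \<open>\<omega> powr (1 / p)\<close>. A power of a
  superadditive function need not be superadditive, so what is kept is monotonicity in the
  interval.\<close>

locale controlled_path =
  fixes T :: real and w :: "real \<Rightarrow> real \<Rightarrow> real" and x :: "real \<Rightarrow> 'w::euclidean_space"
  assumes w_nonneg: "\<lbrakk>0 \<le> s; s \<le> t; t \<le> T\<rbrakk> \<Longrightarrow> 0 \<le> w s t"
    and w_mono: "\<lbrakk>0 \<le> s'; s' \<le> s; s \<le> t; t \<le> t'; t' \<le> T\<rbrakk> \<Longrightarrow> w s t \<le> w s' t'"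
    and x_bound: "\<lbrakk>0 \<le> s; s \<le> t; t \<le> T\<rbrakk> \<Longrightarrow> norm (x t - x s) \<le> w s t"
begin

text \<open>An arbitrary \<open>I\<close> allows intersections with half-lines and with balls of
  times. The sign of \<open>C\<close> is fixed so that constants can be added and enlarged.\<close>

definition controlled ::
  "real set \<Rightarrow> (real \<Rightarrow> 'v::real_normed_vector) \<Rightarrow> (real \<Rightarrow> 'w \<Rightarrow>\<^sub>L 'v) \<Rightarrow> bool" where
  "controlled I z z' \<longleftrightarrow> (\<exists>C\<ge>0. \<forall>s\<in>I. \<forall>t\<in>I. s \<le> t \<longrightarrow>
     norm (z t - z s - blinfun_apply (z' s) (x t - x s)) \<le> C * (w s t)\<^sup>2 \<and>
     norm (z' t - z' s) \<le> C * w s t)"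

lemma controlled_mono: "controlled I z z' \<Longrightarrow> I' \<subseteq> I \<Longrightarrow> controlled I' z z'"
  unfolding controlled_def by (meson subsetD)

lemma controlledE:
  assumes "controlled I z z'"
  obtains C where "0 \<le> C"
    and "\<And>s t. \<lbrakk>s \<in> I; t \<in> I; s \<le> t\<rbrakk> \<Longrightarrow>
      norm (z t - z s - blinfun_apply (z' s) (x t - x s)) \<le> C * (w s t)\<^sup>2"
    and "\<And>s t. \<lbrakk>s \<in> I; t \<in> I; s \<le> t\<rbrakk> \<Longrightarrow> norm (z' t - z' s) \<le> C * w s t"
  using assms unfolding controlled_def by blast

lemma controlled_glue:
  assumes J: "J \<subseteq> {0..T}" "m \<in> J"
    and left: "controlled (J \<inter> {..m}) z z'" and right: "controlled (J \<inter> {m..}) z z'"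
  shows "controlled J z z'"
proof -
  obtain C where C: "0 \<le> C"
    "\<And>s t. \<lbrakk>s \<in> J \<inter> {..m}; t \<in> J \<inter> {..m}; s \<le> t\<rbrakk> \<Longrightarrow>
      norm (z t - z s - blinfun_apply (z' s) (x t - x s)) \<le> C * (w s t)\<^sup>2"
    "\<And>s t. \<lbrakk>s \<in> J \<inter> {..m}; t \<in> J \<inter> {..m}; s \<le> t\<rbrakk> \<Longrightarrow> norm (z' t - z' s) \<le> C * w s t"
    by (rule controlledE[OF left]) blast
  obtain D where D: "0 \<le> D"
    "\<And>s t. \<lbrakk>s \<in> J \<inter> {m..}; t \<in> J \<inter> {m..}; s \<le> t\<rbrakk> \<Longrightarrow>
      norm (z t - z s - blinfun_apply (z' s) (x t - x s)) \<le> D * (w s t)\<^sup>2"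
    "\<And>s t. \<lbrakk>s \<in> J \<inter> {m..}; t \<in> J \<inter> {m..}; s \<le> t\<rbrakk> \<Longrightarrow> norm (z' t - z' s) \<le> D * w s t"
    by (rule controlledE[OF right]) blast
  \<comment> \<open>One \<open>C\<close> comes from the left piece, \<open>D\<close> from the right
    piece, and the second \<open>C\<close> from the cross term at \<open>m\<close>.\<close>
  have "norm (z t - z s - blinfun_apply (z' s) (x t - x s)) \<le> (2 * C + D) * (w s t)\<^sup>2 \<and>
      norm (z' t - z' s) \<le> (2 * C + D) * w s t" if s: "s \<in> J" and t: "t \<in> J" and st: "s \<le> t" for s t
  proof -
    have st': "0 \<le> s" "t \<le> T" using s t J by auto
    have w0: "0 \<le> w s t" using w_nonneg st' st by blast
    consider "t \<le> m" | "m \<le> s" | "s \<le> m" "m \<le> t" by linarith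
    then show ?thesis
    proof cases
      case 1
      have "norm (z t - z s - blinfun_apply (z' s) (x t - x s)) \<le> C * (w s t)\<^sup>2"
        "norm (z' t - z' s) \<le> C * w s t"
        using C(2,3)[of s t] 1 s t st by auto
      moreover have "C * (w s t)\<^sup>2 \<le> (2 * C + D) * (w s t)\<^sup>2" "C * w s t \<le> (2 * C + D) * w s t"
        using C(1) D(1) w0 by (auto intro: mult_right_mono)
      ultimately show ?thesis by linarith
    next
      case 2
      have "norm (z t - z s - blinfun_apply (z' s) (x t - x s)) \<le> D * (w s t)\<^sup>2"
        "norm (z' t - z' s) \<le> D * w s t"
        using D(2,3)[of s t] 2 s t st by auto
      moreover have "D * (w s t)\<^sup>2 \<le> (2 * C + D) * (w s t)\<^sup>2" "D * w s t \<le> (2 * C + D) * w s t"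
        using C(1) D(1) w0 by (auto intro: mult_right_mono)
      ultimately show ?thesis by linarith
    next
      case 3
      have w1: "0 \<le> w s m" "w s m \<le> w s t" "0 \<le> w m t" "w m t \<le> w s t"
        using 3 st' w_nonneg[of s m] w_nonneg[of m t] w_mono[of s s m t] w_mono[of s m t t] by auto
      have w2: "(w s m)\<^sup>2 \<le> (w s t)\<^sup>2" "(w m t)\<^sup>2 \<le> (w s t)\<^sup>2" "w s m * w m t \<le> (w s t)\<^sup>2"
        using w1 by (auto intro!: power_mono mult_mono simp: power2_eq_square)
      let ?R = "\<lambda>s t. z t - z s - blinfun_apply (z' s) (x t - x s)"
      have "?R s t = ?R s m + ?R m t + blinfun_apply (z' m - z' s) (x t - x m)"
        by (simp add: blinfun.diff_left blinfun.diff_right)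
      also have "norm \<dots> \<le> norm (?R s m) + norm (?R m t) + norm (z' m - z' s) * norm (x t - x m)"
        by (rule norm_triangle_le[OF add_mono[OF norm_triangle_ineq norm_blinfun]])
      also have "\<dots> \<le> C * (w s m)\<^sup>2 + D * (w m t)\<^sup>2 + (C * w s m) * w m t"
        using C(2,3)[of s m] D(2)[of m t] x_bound[of m t] 3 s t st' J(2) C(1) w1(1)
        by (intro add_mono mult_mono) auto
      also have "\<dots> \<le> C * (w s t)\<^sup>2 + D * (w s t)\<^sup>2 + C * (w s t)\<^sup>2"
        unfolding mult.assoc using w2 C(1) D(1) by (intro add_mono mult_left_mono)
      finally have R: "norm (?R s t) \<le> (2 * C + D) * (w s t)\<^sup>2" by (simp add: algebra_simps)
      have "norm (z' t - z' s) \<le> norm (z' t - z' m) + norm (z' m - z' s)"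
        using norm_triangle_ineq[of "z' t - z' m" "z' m - z' s"] by simp
      also have "\<dots> \<le> D * w m t + C * w s m"
        using C(3)[of s m] D(3)[of m t] 3 s t J(2) by (intro add_mono) auto
      also have "\<dots> \<le> D * w s t + (2 * C) * w s t"
        using w1 C(1) D(1) by (intro add_mono mult_mono) auto
      finally show ?thesis using R by (simp add: algebra_simps)
    qed
  qed
  then show ?thesis unfolding controlled_def using C(1) D(1) by (intro exI[of _ "2 * C + D"]) auto
qed

lemma controlled_local_imp:
  assumes "0 \<le> a" "a \<le> b" "b \<le> T"
    and loc: "\<And>r. r \<in> {a..b} \<Longrightarrow> \<exists>d>0. controlled (ball r d \<inter> {a..b}) z z'"
  shows "controlled {a..b} z z'"
proof -
  have "controlled ({a..b} \<inter> {a..b}) z z'"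
    using assms(2)
  \<comment> \<open>\<open>Bolzano\<close> also tests intervals that leave \<open>{a..b}\<close>;
    the intersection discards the part outside.\<close>
  proof (induction rule: Bolzano[where P = "\<lambda>u v. controlled ({u..v} \<inter> {a..b}) z z'"])
    case (trans u m v)
    show ?case
    proof (cases "m \<in> {a..b}")
      case True
      have "{u..v} \<inter> {a..b} \<inter> {..m} = {u..m} \<inter> {a..b}" "{u..v} \<inter> {a..b} \<inter> {m..} = {m..v} \<inter> {a..b}"
        using trans(3,4) by auto
      with True show ?thesis
        using trans assms by (intro controlled_glue[of "{u..v} \<inter> {a..b}" m]) auto
    next
      case False
      \<comment> \<open>An \<open>m\<close> outside \<open>{a..b}\<close> lies to one side of it, so
        one of the two pieces already contains everything.\<close>
      then have "{u..v} \<inter> {a..b} \<subseteq> {u..m} \<inter> {a..b} \<or> {u..v} \<inter> {a..b} \<subseteq> {m..v} \<inter> {a..b}"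
        by auto
      then show ?thesis using trans(1,2) controlled_mono by blast
    qed
  next
    case (local r)
    then obtain d where d: "d > 0" "controlled (ball r d \<inter> {a..b}) z z'" using loc[of r] by auto
    have "controlled ({u..v} \<inter> {a..b}) z z'" if "u \<le> r \<and> r \<le> v \<and> v - u < d" for u v
      by (rule controlled_mono[OF d(2)]) (use that in \<open>auto simp: dist_real_def\<close>)
    with d(1) show ?case by blast
  qed
  then show ?thesis by simp
qed

text \<open>The new remainder is the Taylor remainder of \<open>g\<close>, quadratic in the
  increment of \<open>z\<close>, plus the derivative of \<open>g\<close> applied to the remainder of
  \<open>z\<close>; the increment of \<open>w'\<close> splits as in the product rule.
  \<open>w'\<close> is given by a pointwise identity because on the manifold it is produced by
  \<open>differential_comp\<close>.\<close>

lemma controlled_compose: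
  fixes g :: "'a::euclidean_space \<Rightarrow> 'b::real_normed_vector"
  assumes z: "controlled I z z'" and I: "I \<subseteq> {0..T}"
    and B: "z ` I \<subseteq> B" "compact B" "convex B" "B \<subseteq> U" and g: "Cn_on 2 U g"
    and w': "\<And>s v. s \<in> I \<Longrightarrow>
      blinfun_apply (w' s) v = frechet_derivative g (at (z s)) (blinfun_apply (z' s) v)"
  shows "controlled I (\<lambda>s. g (z s)) w'"
proof (cases "I = {}")
  case True
  then show ?thesis by (auto simp: controlled_def)
next
  case False
  then obtain r where r: "r \<in> I" by blast
  let ?D = "\<lambda>u. frechet_derivative g (at u)"
  obtain C where C: "0 \<le> C"
    "\<And>s t. \<lbrakk>s \<in> I; t \<in> I; s \<le> t\<rbrakk> \<Longrightarrow>
      norm (z t - z s - blinfun_apply (z' s) (x t - x s)) \<le> C * (w s t)\<^sup>2"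
    "\<And>s t. \<lbrakk>s \<in> I; t \<in> I; s \<le> t\<rbrakk> \<Longrightarrow> norm (z' t - z' s) \<le> C * w s t"
    by (rule controlledE[OF z]) blast
  obtain K where K: "0 \<le> K" "\<And>u v. u \<in> B \<Longrightarrow> norm (?D u v) \<le> K * norm v"
    "\<And>u u' v. u \<in> B \<Longrightarrow> u' \<in> B \<Longrightarrow> norm (?D u' v - ?D u v) \<le> K * norm (u' - u) * norm v"
    "\<And>u u'. u \<in> B \<Longrightarrow> u' \<in> B \<Longrightarrow> norm (g u' - g u - ?D u (u' - u)) \<le> K * (norm (u' - u))\<^sup>2"
    by (rule C2_bounds[OF g B(2-4)]) blast
  have lin: "linear (?D u)" if "u \<in> B" for u
  proof -
    have "(g has_derivative ?D u) (at u)"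
      using g B(4) that by (intro Cn_on_SucD(1)[of "Suc 0" U]) (auto simp: numeral_2_eq_2)
    then show ?thesis by (rule has_derivative_linear)
  qed
  define W where "W = w 0 T"
  have wW: "0 \<le> w s t" "w s t \<le> W" if "s \<in> I" "t \<in> I" "s \<le> t" for s t
  proof -
    have "0 \<le> s" "t \<le> T" using that I by auto
    then show "0 \<le> w s t" "w s t \<le> W"
      using that(3) w_nonneg[of s t] w_mono[of 0 s t T] by (auto simp: W_def)
  qed
  have W0: "0 \<le> W" using wW[OF r r] by linarith
  \<comment> \<open>\<open>z'\<close> stays within \<open>C * W\<close> of its value at the base
    time \<open>r\<close>; the empty \<open>I\<close>, which has no such time, was treated
    apart.\<close>
  define N where "N = norm (z' r) + C * W"
  have N0: "0 \<le> N" using C(1) W0 by (simp add: N_def)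
  have N: "norm (z' s) \<le> N" if s: "s \<in> I" for s
  proof -
    have "norm (z' s - z' r) \<le> C * W"
    proof (cases "s \<le> r")
      case True
      then show ?thesis
        using C(3)[OF s r True] mult_left_mono[OF wW(2)[OF s r True] C(1)] norm_minus_commute[of "z' s" "z' r"]
        by linarith
    next
      case False
      then have rs: "r \<le> s" by simp
      show ?thesis using C(3)[OF r s rs] mult_left_mono[OF wW(2)[OF r s rs] C(1)] by linarith
    qed
    then show ?thesis using norm_triangle_sub[of "z' s" "z' r"] unfolding N_def by linarith
  qed
  \<comment> \<open>A Lipschitz constant of \<open>z\<close> relative to \<open>w\<close>: in
    \<open>C * w^2 + N * w\<close> one factor of the square is bounded by \<open>W\<close>.\<close>
  define L where "L = C * W + N"
  have L0: "0 \<le> L" using C(1) W0 N0 by (simp add: L_def)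
  \<comment> \<open>\<open>K * L^2\<close> is for the Taylor remainder, \<open>K * C\<close> for the
    derivative of \<open>g\<close> on the remainder of \<open>z\<close> and again on the increment
    of \<open>z'\<close>, and \<open>K * L * N\<close> for the increment of the derivative of
    \<open>g\<close> applied to \<open>z'\<close>.\<close>
  define E where "E = K * L\<^sup>2 + K * C + K * L * N"
  have "norm (g (z t) - g (z s) - blinfun_apply (w' s) (x t - x s)) \<le> E * (w s t)\<^sup>2 \<and>
      norm (w' t - w' s) \<le> E * w s t" if s: "s \<in> I" and t: "t \<in> I" and st: "s \<le> t" for s t
  proof -
    have zB: "z s \<in> B" "z t \<in> B" using s t B(1) by auto
    note w = wW[OF s t st]
    let ?R = "z t - z s - blinfun_apply (z' s) (x t - x s)"
    have x: "norm (x t - x s) \<le> w s t" using s t st I by (intro x_bound) auto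
    have R: "norm ?R \<le> C * (w s t)\<^sup>2" using C(2)[OF s t st] .
    have "norm (z t - z s) \<le> norm ?R + norm (blinfun_apply (z' s) (x t - x s))"
      using norm_triangle_ineq[of ?R "blinfun_apply (z' s) (x t - x s)"] by simp
    also have "\<dots> \<le> C * (w s t)\<^sup>2 + N * w s t"
      by (intro add_mono R order_trans[OF norm_blinfun] mult_mono N s x N0 norm_ge_zero)
    also have "\<dots> \<le> L * w s t"
      using mult_left_mono[OF mult_right_mono[OF w(2) w(1)] C(1)]
      by (simp add: L_def power2_eq_square algebra_simps)
    finally have dz: "norm (z t - z s) \<le> L * w s t" .
    have "g (z t) - g (z s) - blinfun_apply (w' s) (x t - x s) =
        (g (z t) - g (z s) - ?D (z s) (z t - z s)) + ?D (z s) ?R"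
      by (simp add: w'[OF s] linear_diff[OF lin[OF zB(1)]])
    also have "norm \<dots> \<le> K * (norm (z t - z s))\<^sup>2 + K * norm ?R"
      by (intro norm_triangle_le add_mono K zB)
    also have "\<dots> \<le> K * (L * w s t)\<^sup>2 + K * (C * (w s t)\<^sup>2)"
      by (intro add_mono mult_left_mono power_mono dz R K norm_ge_zero)
    also have "\<dots> \<le> E * (w s t)\<^sup>2"
      using K(1) L0 N0 by (simp add: E_def power_mult_distrib algebra_simps)
    finally have 1: "norm (g (z t) - g (z s) - blinfun_apply (w' s) (x t - x s)) \<le> E * (w s t)\<^sup>2" .
    have "norm (w' t - w' s) \<le> K * C * w s t + K * L * N * w s t"
    proof (rule norm_blinfun_bound)
      show "0 \<le> K * C * w s t + K * L * N * w s t" using K(1) C(1) L0 N0 w by simp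
      fix v
      have "blinfun_apply (w' t - w' s) v = ?D (z t) (blinfun_apply (z' t - z' s) v) +
          (?D (z t) (blinfun_apply (z' s) v) - ?D (z s) (blinfun_apply (z' s) v))"
        by (simp add: w'[OF s] w'[OF t] blinfun.diff_left linear_diff[OF lin[OF zB(2)]])
      also have "norm \<dots> \<le> K * norm (blinfun_apply (z' t - z' s) v)
          + K * norm (z t - z s) * norm (blinfun_apply (z' s) v)"
        by (intro norm_triangle_le add_mono K zB)
      also have "\<dots> \<le> K * (C * w s t * norm v) + K * (L * w s t) * (N * norm v)"
      proof -
        have "norm (blinfun_apply (z' t - z' s) v) \<le> C * w s t * norm v"
          by (rule order_trans[OF norm_blinfun]) (intro mult_right_mono C(3) s t st norm_ge_zero)
        moreover have "norm (blinfun_apply (z' s) v) \<le> N * norm v"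
          by (rule order_trans[OF norm_blinfun]) (intro mult_right_mono N s norm_ge_zero)
        ultimately show ?thesis
          using K(1) L0 w(1) dz by (intro add_mono mult_mono) auto
      qed
      finally show "norm (blinfun_apply (w' t - w' s) v) \<le> (K * C * w s t + K * L * N * w s t) * norm v"
        by (simp add: algebra_simps)
    qed
    also have "\<dots> \<le> E * w s t"
      using K(1) w by (simp add: E_def algebra_simps)
    finally show ?thesis using 1 by blast
  qed
  moreover have "0 \<le> E" using K(1) C(1) L0 N0 by (simp add: E_def)
  ultimately show ?thesis unfolding controlled_def by blast
qed

text \<open>The norm is at most the sum of the absolute coordinates, so the constants add up. The
  families \<open>h\<close> and \<open>h'\<close> have to match \<open>z\<close> and
  \<open>z'\<close> on \<open>I\<close> alone, since cut-off coordinate functions agree with a chart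
  only near a point.\<close>

lemma controlled_componentwise:
  fixes z :: "real \<Rightarrow> real ^ 'n"
  assumes c: "\<And>i. controlled I (h i) (h' i)" and I: "I \<subseteq> {0..T}"
    and h: "\<And>i s. s \<in> I \<Longrightarrow> h i s = z s $ i"
    and h': "\<And>i s v. s \<in> I \<Longrightarrow> blinfun_apply (h' i s) v = blinfun_apply (z' s) v $ i"
  shows "controlled I z z'"
proof -
  have "\<exists>C\<ge>0. \<forall>s\<in>I. \<forall>t\<in>I. s \<le> t \<longrightarrow>
     norm (h i t - h i s - blinfun_apply (h' i s) (x t - x s)) \<le> C * (w s t)\<^sup>2 \<and>
     norm (h' i t - h' i s) \<le> C * w s t" for i
    using c[of i] unfolding controlled_def .
  then obtain C where C0: "\<And>i. 0 \<le> C i"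
    and C: "\<And>i s t. \<lbrakk>s \<in> I; t \<in> I; s \<le> t\<rbrakk> \<Longrightarrow>
       norm (h i t - h i s - blinfun_apply (h' i s) (x t - x s)) \<le> C i * (w s t)\<^sup>2"
    "\<And>i s t. \<lbrakk>s \<in> I; t \<in> I; s \<le> t\<rbrakk> \<Longrightarrow> norm (h' i t - h' i s) \<le> C i * w s t"
    by metis
  have "norm (z t - z s - blinfun_apply (z' s) (x t - x s)) \<le> sum C UNIV * (w s t)\<^sup>2 \<and>
     norm (z' t - z' s) \<le> sum C UNIV * w s t" if s: "s \<in> I" and t: "t \<in> I" and st: "s \<le> t" for s t
  proof
    have "norm (z t - z s - blinfun_apply (z' s) (x t - x s))
        \<le> (\<Sum>i\<in>UNIV. \<bar>(z t - z s - blinfun_apply (z' s) (x t - x s)) $ i\<bar>)"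
      by (rule norm_le_l1_cart)
    also have "\<dots> \<le> (\<Sum>i\<in>UNIV. C i * (w s t)\<^sup>2)"
      using C(1)[OF s t st] by (intro sum_mono) (simp add: h[OF s] h[OF t] h'[OF s])
    finally show "norm (z t - z s - blinfun_apply (z' s) (x t - x s)) \<le> sum C UNIV * (w s t)\<^sup>2"
      by (simp add: sum_distrib_right)
    have w0: "0 \<le> w s t" using s t st I by (intro w_nonneg) auto
    show "norm (z' t - z' s) \<le> sum C UNIV * w s t"
    proof (rule norm_blinfun_bound)
      show "0 \<le> sum C UNIV * w s t" using C0 w0 by (simp add: sum_nonneg)
      fix v
      have "norm (blinfun_apply (z' t - z' s) v) \<le> (\<Sum>i\<in>UNIV. \<bar>blinfun_apply (z' t - z' s) v $ i\<bar>)"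
        by (rule norm_le_l1_cart)
      also have "\<dots> = (\<Sum>i\<in>UNIV. norm (blinfun_apply (h' i t - h' i s) v))"
        by (simp add: blinfun.diff_left h'[OF s] h'[OF t])
      also have "\<dots> \<le> (\<Sum>i\<in>UNIV. C i * w s t * norm v)"
        by (intro sum_mono order_trans[OF norm_blinfun] mult_right_mono C(2) s t st norm_ge_zero)
      finally show "norm (blinfun_apply (z' t - z' s) v) \<le> sum C UNIV * w s t * norm v"
        by (simp add: sum_distrib_right)
    qed
  qed
  then show ?thesis unfolding controlled_def using C0 by (intro exI[of _ "sum C UNIV"]) (auto simp: sum_nonneg)
qed

end

lemma controlled_path_rough_path:
  assumes "1 \<le> p" and om: "control T \<omega>" and "weak_geometric_rough_path T p \<omega> X"
  shows "controlled_path T (\<lambda>s t. \<omega> s t powr (1 / p)) (fst X)"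
proof
  have nonneg: "0 \<le> \<omega> s t" if "0 \<le> s" "s \<le> t" "t \<le> T" for s t
    using om that unfolding control_def simplex2_def by auto
  show "0 \<le> \<omega> s t powr (1 / p)" for s t by simp
  show "\<omega> s t powr (1 / p) \<le> \<omega> s' t' powr (1 / p)"
    if "0 \<le> s'" "s' \<le> s" "s \<le> t" "t \<le> t'" "t' \<le> T" for s t s' t'
  proof (rule powr_mono2)
    have add: "\<omega> a b + \<omega> b c \<le> \<omega> a c" if "0 \<le> a" "a \<le> b" "b \<le> c" "c \<le> T" for a b c
      using om that unfolding control_def by blast
    \<comment> \<open>Cut the large interval at \<open>s\<close>, then its right part at
      \<open>t\<close>, and drop the nonnegative outer pieces.\<close>
    show "\<omega> s t \<le> \<omega> s' t'"
      using add[of s' s t'] add[of s t t'] nonneg[of s' s] nonneg[of t t'] that by linarith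
  qed (use that assms(1) nonneg in auto)
  show "norm (fst X t - fst X s) \<le> \<omega> s t powr (1 / p)" if "0 \<le> s" "s \<le> t" "t \<le> T" for s t
    using assms(3) that unfolding weak_geometric_rough_path_def simplex2_def
    by (auto simp: case_prod_beta)
qed

subsection \<open>Charts and differentials\<close>

lemma topological_chart_inj: "topological_chart M c \<Longrightarrow> inj_on (map_chart c) (dom_chart c)"
  unfolding topological_chart_def
  by (metis homeomorphic_imp_injective_map openin_subset topspace_subtopology_subset)

lemma inv_chart_map_chart:
  "\<lbrakk>topological_chart M c; q \<in> dom_chart c\<rbrakk> \<Longrightarrow> inv_chart c (map_chart c q) = q"
  by (simp add: topological_chart_inj inv_into_f_f)

lemma topological_chart_open_image:
  assumes c: "topological_chart M c" and W: "openin M W" "W \<subseteq> dom_chart c"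
  shows "open (map_chart c ` W)"
proof -
  have D: "openin M (dom_chart c)" "open (map_chart c ` dom_chart c)"
    and hom: "homeomorphic_map (subtopology M (dom_chart c)) (top_of_set (map_chart c ` dom_chart c)) (map_chart c)"
    using c unfolding topological_chart_def by auto
  have "openin (subtopology M (dom_chart c)) W"
    using W D(1) by (simp add: openin_open_subtopology)
  moreover have "open_map (subtopology M (dom_chart c)) (top_of_set (map_chart c ` dom_chart c)) (map_chart c)"
    using hom by (simp add: homeomorphic_eq_everything_map)
  ultimately have "openin (top_of_set (map_chart c ` dom_chart c)) (map_chart c ` W)"
    unfolding open_map_def by blast
  then show ?thesis using D(2) openin_open_trans by blast
qed

lemma topological_chart_open_preimage:
  assumes c: "topological_chart M c" and V: "open V"
  shows "openin M {q \<in> dom_chart c. map_chart c q \<in> V}"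
proof -
  have D: "openin M (dom_chart c)"
    and hom: "homeomorphic_map (subtopology M (dom_chart c)) (top_of_set (map_chart c ` dom_chart c)) (map_chart c)"
    using c unfolding topological_chart_def by auto
  have "continuous_map (subtopology M (dom_chart c)) euclidean (map_chart c)"
    using homeomorphic_imp_continuous_map[OF hom] by (rule continuous_map_into_fulltopology)
  from openin_continuous_map_preimage[OF this, of V] V
  have "openin (subtopology M (dom_chart c)) {q \<in> topspace M \<inter> dom_chart c. map_chart c q \<in> V}"
    by simp
  moreover have "topspace M \<inter> dom_chart c = dom_chart c" using openin_subset[OF D] by blast
  ultimately show ?thesis using D by (simp add: openin_open_subtopology)
qed

lemma smooth_manifold_chart:
  "\<lbrakk>smooth_manifold M \<A>; c \<in> \<A>\<rbrakk> \<Longrightarrow> topological_chart M c"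
  unfolding smooth_manifold_def by blast

lemma smooth_manifold_compatible:
  "\<lbrakk>smooth_manifold M \<A>; c \<in> \<A>; c' \<in> \<A>\<rbrakk> \<Longrightarrow> smoothly_compatible c c'"
  unfolding smooth_manifold_def by blast

lemma smooth_manifold_open_overlap:
  assumes "smooth_manifold M \<A>" "c \<in> \<A>" "c' \<in> \<A>"
  shows "open (map_chart c ` (dom_chart c \<inter> dom_chart c'))"
proof (rule topological_chart_open_image)
  show "topological_chart M c" using smooth_manifold_chart assms by blast
  show "openin M (dom_chart c \<inter> dom_chart c')"
    using smooth_manifold_chart[OF assms(1)] assms(2,3) unfolding topological_chart_def by blast
qed simp

text \<open>\<open>differential\<close> evaluates in some chosen chart \<open>b\<close>. Near
  \<open>p\<close>, \<open>F\<close> read in \<open>b\<close> is \<open>F\<close> read in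
  \<open>c\<close> after the change of coordinates; the chain rule and the transformation law in
  \<open>tangent_space\<close> then remove the dependence on \<open>b\<close>.\<close>

lemma differential_in_chart:
  assumes M: "smooth_manifold M \<A>" and c: "c \<in> \<A>" "p \<in> dom_chart c"
    and \<xi>: "\<xi> \<in> tangent_space \<A> p"
    and F: "(F \<circ> inv_chart c) differentiable (at (map_chart c p))"
  shows "differential \<A> F p \<xi> = frechet_derivative (F \<circ> inv_chart c) (at (map_chart c p)) (\<xi> c)"
proof -
  define b where "b = (SOME c. c \<in> \<A> \<and> p \<in> dom_chart c)"
  have b: "b \<in> \<A>" "p \<in> dom_chart b"
    using someI[of "\<lambda>c. c \<in> \<A> \<and> p \<in> dom_chart c" c] c unfolding b_def by blast+
  note tb = smooth_manifold_chart[OF M b(1)] and tc = smooth_manifold_chart[OF M c(1)]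
  let ?h = "map_chart c \<circ> inv_chart b" and ?S = "map_chart b ` (dom_chart b \<inter> dom_chart c)"
  have "Cn_on (Suc 0) ?S ?h"
    using smooth_manifold_compatible[OF M b(1) c(1)] unfolding smoothly_compatible_def smooth_on_def by blast
  then have h: "?h differentiable (at (map_chart b p))" using b c by simp
  have hp: "?h (map_chart b p) = map_chart c p" by (simp add: inv_chart_map_chart[OF tb b(2)])
  have "frechet_derivative (F \<circ> inv_chart b) (at (map_chart b p)) =
      frechet_derivative ((F \<circ> inv_chart c) \<circ> ?h) (at (map_chart b p))"
  proof (rule frechet_derivative_transform_within_open[symmetric])
    show "((F \<circ> inv_chart c) \<circ> ?h) differentiable (at (map_chart b p))"
      using h F hp by (intro differentiable_chain_at) auto
    show "open ?S" by (rule smooth_manifold_open_overlap[OF M b(1) c(1)])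
    show "map_chart b p \<in> ?S" using b c by blast
    show "((F \<circ> inv_chart c) \<circ> ?h) u = (F \<circ> inv_chart b) u" if "u \<in> ?S" for u
      using that by (auto simp: inv_chart_map_chart[OF tb] inv_chart_map_chart[OF tc])
  qed
  also have "\<dots> = frechet_derivative (F \<circ> inv_chart c) (at (map_chart c p)) \<circ>
      frechet_derivative ?h (at (map_chart b p))"
    using h F hp by (subst frechet_derivative_compose) auto
  moreover have "\<xi> c = frechet_derivative ?h (at (map_chart b p)) (\<xi> b)"
    using \<xi> b c unfolding tangent_space_def by blast
  ultimately show ?thesis
    unfolding differential_def Let_def b_def[symmetric] by simp
qed

text \<open>\<open>Blinfun\<close> can be evaluated once its argument is bounded linear; linearity
  of \<open>A\<close> at the index \<open>c\<close> and finite dimension supply this.\<close>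

lemma differential_comp_map_chart_apply:
  fixes A :: "real ^ 'k \<Rightarrow> ('m, 'd::finite) tangent"
  assumes "c \<in> \<A>" "p \<in> dom_chart c" "A \<in> hom_tangent \<A> p"
  shows "blinfun_apply (differential_comp \<A> (map_chart c) p A) v = A v c"
proof -
  have "(\<lambda>w. differential \<A> (map_chart c) p (A w)) = (\<lambda>w. A w c)"
    using assms by (auto simp: hom_tangent_def differential_map_chart)
  moreover have "bounded_linear (\<lambda>w. A w c)"
    using assms(3) unfolding hom_tangent_def linear_conv_bounded_linear by blast
  ultimately show ?thesis
    unfolding differential_comp_def by (simp add: bounded_linear_Blinfun_apply)
qed

text \<open>The chain rule in the form of the hypothesis on \<open>w'\<close> in
  \<open>controlled_compose\<close>.\<close>

lemma differential_comp_apply: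
  fixes A :: "real ^ 'k \<Rightarrow> ('m, 'd::finite) tangent"
  assumes M: "smooth_manifold M \<A>" and c: "c \<in> \<A>" "p \<in> dom_chart c"
    and A: "A \<in> hom_tangent \<A> p"
    and F: "(F \<circ> inv_chart c) differentiable (at (map_chart c p))"
  shows "blinfun_apply (differential_comp \<A> F p A) v =
    frechet_derivative (F \<circ> inv_chart c) (at (map_chart c p))
      (blinfun_apply (differential_comp \<A> (map_chart c) p A) v)"
proof -
  let ?D = "frechet_derivative (F \<circ> inv_chart c) (at (map_chart c p))"
  have "(\<lambda>w. differential \<A> F p (A w)) = (\<lambda>w. ?D (A w c))"
    using A by (intro ext differential_in_chart[OF M c _ F]) (auto simp: hom_tangent_def)
  moreover have "bounded_linear (\<lambda>w. ?D (A w c))"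
  proof -
    have "linear (\<lambda>w. A w c)" using A unfolding hom_tangent_def by blast
    from linear_compose[OF this linear_frechet_derivative[OF F]]
    show ?thesis by (simp add: o_def linear_conv_bounded_linear)
  qed
  ultimately show ?thesis
    using differential_comp_map_chart_apply[OF c A]
    unfolding differential_comp_def[of _ F] by (simp add: bounded_linear_Blinfun_apply)
qed

text \<open>
  The Hausdorff property makes the compact support closed in the whole manifold, so that the
  extension vanishes on an open set.
\<close>

lemma smooth_functions_extension_by_zero:
  fixes G :: "real ^ 'd::finite \<Rightarrow> real"
  assumes M: "smooth_manifold M \<A>" and c: "c \<in> \<A>"
    and G: "smooth_on UNIV G" and K: "compact K" "K \<subseteq> map_chart c ` dom_chart c"
    and supp: "\<And>u. u \<notin> K \<Longrightarrow> G u = 0"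
  shows "(\<lambda>q. if q \<in> dom_chart c then G (map_chart c q) else 0) \<in> smooth_functions \<A>"
proof -
  let ?f = "\<lambda>q. if q \<in> dom_chart c then G (map_chart c q) else 0"
  let ?K = "{q \<in> dom_chart c. map_chart c q \<in> K}"
  note tc = smooth_manifold_chart[OF M c]
  have D: "openin M (dom_chart c)"
    and hom: "homeomorphic_map (subtopology M (dom_chart c)) (top_of_set (map_chart c ` dom_chart c)) (map_chart c)"
    using tc unfolding topological_chart_def by auto
  have image: "map_chart c ` ?K = K" using K(2) by blast
  have "compactin (top_of_set (map_chart c ` dom_chart c)) (map_chart c ` ?K)"
    unfolding image compactin_subtopology using K by simp
  moreover have "?K \<subseteq> topspace (subtopology M (dom_chart c))"
    using openin_subset[OF D] by auto
  ultimately have "compactin (subtopology M (dom_chart c)) ?K"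
    using homeomorphic_map_compactness[OF hom] by blast
  then have "compactin M ?K" unfolding compactin_subtopology by (rule conjunct1)
  moreover have "Hausdorff_space M" using M unfolding smooth_manifold_def by (rule conjunct1)
  ultimately have closed: "closedin M ?K" by (intro compactin_imp_closedin)
  have "Cn_on n (map_chart b ` dom_chart b) (?f \<circ> inv_chart b)" if b: "b \<in> \<A>" for b n
  proof -
    note tb = smooth_manifold_chart[OF M b]
    \<comment> \<open>Two open sets that cover the image of \<open>b\<close>, because
      \<open>?K\<close> lies in the domain of \<open>c\<close>. On the first the function is
      \<open>G\<close> after a transition map, on the second it is zero.\<close>
    let ?S = "map_chart b ` (dom_chart b \<inter> dom_chart c)" and ?S' = "map_chart b ` (dom_chart b - ?K)"
    have S: "open ?S" by (rule smooth_manifold_open_overlap[OF M b c])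
    have S': "open ?S'"
    proof (rule topological_chart_open_image[OF tb])
      show "openin M (dom_chart b - ?K)"
        by (rule openin_diff[OF _ closed]) (use tb in \<open>simp add: topological_chart_def\<close>)
    qed blast
    have "Cn_on n ?S (map_chart c \<circ> inv_chart b)"
      using smooth_manifold_compatible[OF M b c] unfolding smoothly_compatible_def smooth_on_def by blast
    moreover have "Cn_on n UNIV G" using G unfolding smooth_on_def by (rule spec)
    ultimately have comp: "Cn_on n ?S (\<lambda>u. G ((map_chart c \<circ> inv_chart b) u))"
      by (rule Cn_on_compose[OF S _ _ subset_UNIV])
    have "G ((map_chart c \<circ> inv_chart b) u) = (?f \<circ> inv_chart b) u" if "u \<in> ?S" for u
      using that by (auto simp: inv_chart_map_chart[OF tb])
    then have 1: "Cn_on n ?S (?f \<circ> inv_chart b)"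
      by (rule Cn_on_cong[OF S _ comp])
    have "0 = (?f \<circ> inv_chart b) u" if "u \<in> ?S'" for u
    proof -
      obtain q where "q \<in> dom_chart b" "u = map_chart b q" "q \<in> dom_chart c \<Longrightarrow> map_chart c q \<notin> K"
        using \<open>u \<in> ?S'\<close> by blast
      then show ?thesis by (simp add: inv_chart_map_chart[OF tb] supp)
    qed
    then have 2: "Cn_on n ?S' (?f \<circ> inv_chart b)"
      by (rule Cn_on_cong[OF S' _ Cn_on_const])
    have "map_chart b ` dom_chart b = ?S \<union> ?S'" by blast
    with Cn_on_Un[OF S S' 1 2] show ?thesis by simp
  qed
  then show ?thesis unfolding smooth_functions_def smooth_on_def by blast
qed

subsection \<open>Continuous pairs in the manifold\<close>

context
  fixes M :: "'m topology" and \<A> :: "('m, 'd::finite) chart set" and T :: real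
    and y :: "real \<Rightarrow> 'm" and y' :: "real \<Rightarrow> real ^ 'k \<Rightarrow> ('m, 'd) tangent"
  assumes M: "smooth_manifold M \<A>" and yy': "continuous_manifold_pair T M \<A> (y, y')"
begin

lemma path_hom_tangent: "s \<in> {0..T} \<Longrightarrow> y' s \<in> hom_tangent \<A> (y s)"
  using yy' unfolding continuous_manifold_pair_def by simp

lemma path_in_chart:
  assumes "r \<in> {0..T}"
  obtains c where "c \<in> \<A>" "y r \<in> dom_chart c"
proof -
  have "continuous_map (top_of_set {0..T}) M y"
    using yy' unfolding continuous_manifold_pair_def by simp
  from continuous_map_image_subset_topspace[OF this] assms have "y r \<in> topspace M"
    by (simp add: image_subset_iff)
  then show thesis using M that unfolding smooth_manifold_def by blast
qed

text \<open>Confines the path for a short time to a ball where Taylor's formula applies or a cutoff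
  is 1, or, with \<open>V = UNIV\<close>, just to the chart domain.\<close>

lemma path_stays_in_chart_preimage:
  assumes c: "c \<in> \<A>" and r: "r \<in> {0..T}" "y r \<in> dom_chart c" and V: "open V" "map_chart c (y r) \<in> V"
  obtains d where "0 < d" "\<And>s. s \<in> ball r d \<inter> {0..T} \<Longrightarrow> y s \<in> dom_chart c \<and> map_chart c (y s) \<in> V"
proof -
  let ?W = "{q \<in> dom_chart c. map_chart c q \<in> V}"
  have "continuous_map (top_of_set {0..T}) M y"
    using yy' unfolding continuous_manifold_pair_def by simp
  moreover have "openin M ?W"
    by (rule topological_chart_open_preimage[OF smooth_manifold_chart[OF M c] V(1)])
  ultimately have "openin (top_of_set {0..T}) {s \<in> topspace (top_of_set {0..T}). y s \<in> ?W}"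
    by (rule openin_continuous_map_preimage)
  then have "\<forall>s\<in>{s \<in> topspace (top_of_set {0..T}). y s \<in> ?W}.
      \<exists>d>0. ball s d \<inter> {0..T} \<subseteq> {s \<in> topspace (top_of_set {0..T}). y s \<in> ?W}"
    unfolding openin_contains_ball by (rule conjunct2)
  moreover have "r \<in> {s \<in> topspace (top_of_set {0..T}). y s \<in> ?W}"
    using r V(2) by simp
  ultimately obtain d where "0 < d" "ball r d \<inter> {0..T} \<subseteq> {s \<in> topspace (top_of_set {0..T}). y s \<in> ?W}"
    by blast
  then show thesis by (intro that[of d]) blast+
qed

text \<open>The sets \<open>?G\<close> generate the topology of \<open>hom_bundle\<close>. Since
  \<open>y' s\<close> always lies in the fibre over \<open>y s\<close>, pulling \<open>?G\<close>
  back along the path gives the preimage of \<open>V\<close> under the trivialised path.\<close>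

lemma continuous_on_path_in_chart:
  assumes c: "c \<in> \<A>"
  shows "continuous_on {s \<in> {0..T}. y s \<in> dom_chart c}
    (\<lambda>s. (map_chart c (y s), differential_comp \<A> (map_chart c) (y s) (y' s)))"
    (is "continuous_on ?S ?F")
  unfolding continuous_openin_preimage_eq
proof (intro allI impI)
  fix V :: "((real ^ 'd) \<times> ((real ^ 'k) \<Rightarrow>\<^sub>L (real ^ 'd))) set"
  assume "open V"
  let ?G = "{(p, A). p \<in> dom_chart c \<and> A \<in> hom_tangent \<A> p \<and>
    (map_chart c p, differential_comp \<A> (map_chart c) p A) \<in> V}"
  have "openin (hom_bundle \<A>) ?G"
    unfolding hom_bundle_def using c \<open>open V\<close> by (intro topology_generated_by_Basis) blast
  moreover have "continuous_map (top_of_set {0..T}) (hom_bundle \<A>) (\<lambda>s. (y s, y' s))"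
    using yy' unfolding continuous_manifold_pair_def by simp
  ultimately have "openin (top_of_set {0..T}) {s \<in> {0..T}. (y s, y' s) \<in> ?G}"
    using openin_continuous_map_preimage by fastforce
  moreover have "{s \<in> {0..T}. (y s, y' s) \<in> ?G} = ?S \<inter> ?F -` V"
    using path_hom_tangent by auto
  ultimately show "openin (top_of_set ?S) (?S \<inter> ?F -` V)"
    by (auto intro: openin_subset_trans)
qed

lemma push_forward_in_chart:
  assumes f: "f \<in> smooth_functions \<A>" and c: "c \<in> \<A>" and s: "s \<in> {0..T}" "y s \<in> dom_chart c"
  shows "f (y s) = (f \<circ> inv_chart c) (map_chart c (y s))"
    and "blinfun_apply (differential_comp \<A> f (y s) (y' s)) v =
      frechet_derivative (f \<circ> inv_chart c) (at (map_chart c (y s)))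
        (blinfun_apply (differential_comp \<A> (map_chart c) (y s) (y' s)) v)"
proof -
  show "f (y s) = (f \<circ> inv_chart c) (map_chart c (y s))"
    by (simp add: inv_chart_map_chart[OF smooth_manifold_chart[OF M c] s(2)])
  have "Cn_on (Suc 0) (map_chart c ` dom_chart c) (f \<circ> inv_chart c)"
    using f c unfolding smooth_functions_def smooth_on_def by blast
  then have "(f \<circ> inv_chart c) differentiable (at (map_chart c (y s)))" using s by simp
  then show "blinfun_apply (differential_comp \<A> f (y s) (y' s)) v =
      frechet_derivative (f \<circ> inv_chart c) (at (map_chart c (y s)))
        (blinfun_apply (differential_comp \<A> (map_chart c) (y s) (y' s)) v)"
    by (rule differential_comp_apply[OF M c s(2) path_hom_tangent[OF s(1)]])
qed

text \<open>Supplies the two continuity clauses of \<open>CRP\<close>; continuity at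
  \<open>r\<close> is checked in a chart at \<open>y r\<close>.\<close>

lemma continuous_on_push_forward:
  assumes f: "f \<in> smooth_functions \<A>"
  shows "continuous_on {0..T} (\<lambda>s. (f (y s), differential_comp \<A> f (y s) (y' s)))" (is "continuous_on _ ?H")
  unfolding continuous_on_eq_continuous_within
proof
  fix r assume r: "r \<in> {0..T}"
  obtain c where c: "c \<in> \<A>" "y r \<in> dom_chart c" by (rule path_in_chart[OF r])
  let ?S = "{s \<in> {0..T}. y s \<in> dom_chart c}" and ?g = "f \<circ> inv_chart c"
  let ?z = "\<lambda>s. map_chart c (y s)" and ?z' = "\<lambda>s. differential_comp \<A> (map_chart c) (y s) (y' s)"
  have g: "Cn_on (Suc 0) (map_chart c ` dom_chart c) ?g"
    using f c unfolding smooth_functions_def smooth_on_def by blast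
  have z: "continuous_on ?S ?z" and z': "continuous_on ?S ?z'"
    using continuous_on_path_in_chart[OF c(1)] by (auto dest: continuous_on_fst continuous_on_snd)
  have "continuous_on ?S (\<lambda>s. ?g (?z s))"
    by (rule continuous_on_compose2[OF Cn_on_imp_continuous_on[OF g] z]) auto
  then have 1: "continuous_on ?S (\<lambda>s. f (y s))"
    by (rule continuous_on_eq) (use push_forward_in_chart(1)[OF f c(1)] in auto)
  have 2: "continuous_on ?S (\<lambda>s. differential_comp \<A> f (y s) (y' s))"
  proof (rule continuous_on_blinfun_componentwise)
    fix i :: "real ^ 'k"
    have "continuous_on ?S (\<lambda>s. frechet_derivative ?g (at (?z s)) b)" for b
      by (rule continuous_on_compose2[OF Cn_on_imp_continuous_on[OF Cn_on_SucD(2)[OF g]] z]) auto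
    \<comment> \<open>The direction \<open>?z' s i\<close> moves with \<open>s\<close>, hence the
      expansion over the basis.\<close>
    then have "continuous_on ?S (\<lambda>s. \<Sum>b\<in>Basis. (blinfun_apply (?z' s) i \<bullet> b) *\<^sub>R frechet_derivative ?g (at (?z s)) b)"
      by (intro continuous_intros z')
    then show "continuous_on ?S (\<lambda>s. blinfun_apply (differential_comp \<A> f (y s) (y' s)) i)"
    proof (rule continuous_on_eq)
      fix s assume s: "s \<in> ?S"
      have "linear (frechet_derivative ?g (at (?z s)))"
        using s Cn_on_SucD(1)[OF g, THEN has_derivative_linear] by blast
      from s linear_euclidean_sum[OF this, of "blinfun_apply (?z' s) i"] show "(\<Sum>b\<in>Basis. (blinfun_apply (?z' s) i \<bullet> b) *\<^sub>R frechet_derivative ?g (at (?z s)) b) =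
          blinfun_apply (differential_comp \<A> f (y s) (y' s)) i"
        using push_forward_in_chart(2)[OF f c(1), of s i]
        by simp
    qed
  qed
  obtain d where d: "0 < d" "\<And>s. s \<in> ball r d \<inter> {0..T} \<Longrightarrow> y s \<in> dom_chart c \<and> map_chart c (y s) \<in> UNIV"
    using path_stays_in_chart_preimage[OF c(1) r c(2) open_UNIV UNIV_I] by blast
  \<comment> \<open>Near \<open>r\<close> all of \<open>{0..T}\<close> lies in \<open>?S\<close>, so
    both sets give the same limits at \<open>r\<close>.\<close>
  have "at r within {0..T} = at r within ?S"
    by (rule at_within_nhd[of r "ball r d"]) (use d in auto)
  moreover have "continuous (at r within ?S) ?H"
    using continuous_on_Pair[OF 1 2] r c unfolding continuous_on_eq_continuous_within by blast
  ultimately show "continuous (at r within {0..T}) ?H" by simp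
qed

end

section \<open>The two implications in terms of \<open>controlled\<close>\<close>

locale controlled_manifold_path = controlled_path T w x
  for T :: real and w :: "real \<Rightarrow> real \<Rightarrow> real" and x :: "real \<Rightarrow> real ^ 'k" +
  fixes M :: "'m topology" and \<A> :: "('m, 'd::finite) chart set"
    and y :: "real \<Rightarrow> 'm" and y' :: "real \<Rightarrow> real ^ 'k \<Rightarrow> ('m, 'd) tangent"
  assumes M: "smooth_manifold M \<A>" and yy': "continuous_manifold_pair T M \<A> (y, y')"
begin

text \<open>A closed ball inside the open image of a chart is the compact convex set that
  \<open>controlled_compose\<close> asks for.\<close>

lemma controlled_push_forward:
  assumes "0 \<le> T" and f: "f \<in> smooth_functions \<A>"
    and charts: "\<And>c a b. \<lbrakk>c \<in> \<A>; 0 \<le> a; a \<le> b; b \<le> T; y ` {a..b} \<subseteq> dom_chart c\<rbrakk> \<Longrightarrow>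
      controlled {a..b} (\<lambda>s. map_chart c (y s)) (\<lambda>s. differential_comp \<A> (map_chart c) (y s) (y' s))"
  shows "controlled {0..T} (\<lambda>s. f (y s)) (\<lambda>s. differential_comp \<A> f (y s) (y' s))"
proof (rule controlled_local_imp)
  fix r assume r: "r \<in> {0..T}"
  obtain c where c: "c \<in> \<A>" "y r \<in> dom_chart c" by (rule path_in_chart[OF M yy' r])
  let ?g = "f \<circ> inv_chart c" and ?U = "map_chart c ` dom_chart c"
  have "open ?U" using smooth_manifold_chart[OF M c(1)] unfolding topological_chart_def by blast
  then obtain \<rho> where \<rho>: "0 < \<rho>" "cball (map_chart c (y r)) \<rho> \<subseteq> ?U"
    using c(2) unfolding open_contains_cball by blast
  let ?B = "cball (map_chart c (y r)) \<rho>"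
  obtain d where d: "0 < d"
    "\<And>s. s \<in> ball r d \<inter> {0..T} \<Longrightarrow> y s \<in> dom_chart c \<and> map_chart c (y s) \<in> ball (map_chart c (y r)) \<rho>"
    by (rule path_stays_in_chart_preimage[OF M yy' c(1) r c(2), of "ball (map_chart c (y r)) \<rho>"])
      (use \<rho>(1) in auto)
  \<comment> \<open>\<open>charts\<close> speaks of closed intervals; half of \<open>d\<close> keeps
    this one inside the open ball, while it still contains every time of \<open>{0..T}\<close>
    within \<open>d / 2\<close> of \<open>r\<close>.\<close>
  define a where "a = max 0 (r - d / 2)"
  define b where "b = min T (r + d / 2)"
  have ab: "0 \<le> a" "a \<le> b" "b \<le> T" using r d(1) by (auto simp: a_def b_def)
  have I: "{a..b} \<subseteq> ball r d \<inter> {0..T}" using d(1) by (auto simp: a_def b_def dist_real_def)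
  have "controlled {a..b} (\<lambda>s. ?g (map_chart c (y s))) (\<lambda>s. differential_comp \<A> f (y s) (y' s))"
  proof (rule controlled_compose[where U = ?U and B = ?B])
    show "controlled {a..b} (\<lambda>s. map_chart c (y s)) (\<lambda>s. differential_comp \<A> (map_chart c) (y s) (y' s))"
      using I d(2) by (intro charts c ab) blast
    show "(\<lambda>s. map_chart c (y s)) ` {a..b} \<subseteq> ?B"
      using I d(2) ball_subset_cball by blast
    show "Cn_on 2 ?U ?g" using f c(1) unfolding smooth_functions_def smooth_on_def by blast
    fix s v assume "s \<in> {a..b}"
    then have "s \<in> {0..T}" "y s \<in> dom_chart c" using I d(2) by blast+
    then show "blinfun_apply (differential_comp \<A> f (y s) (y' s)) v =
        frechet_derivative ?g (at (map_chart c (y s)))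
          (blinfun_apply (differential_comp \<A> (map_chart c) (y s) (y' s)) v)"
      by (rule push_forward_in_chart(2)[OF M yy' f c(1)])
  qed (use ab \<rho> in auto)
  moreover have "?g (map_chart c (y s)) = f (y s)" if "s \<in> {a..b}" for s
  proof -
    have "s \<in> {0..T}" "y s \<in> dom_chart c" using that I d(2) by blast+
    then show ?thesis by (rule push_forward_in_chart(1)[OF M yy' f c(1), symmetric])
  qed
  ultimately have "controlled {a..b} (\<lambda>s. f (y s)) (\<lambda>s. differential_comp \<A> f (y s) (y' s))"
    unfolding controlled_def by simp
  moreover have "ball r (d / 2) \<inter> {0..T} \<subseteq> {a..b}"
    by (auto simp: a_def b_def dist_real_def abs_if split: if_splits)
  ultimately have "controlled (ball r (d / 2) \<inter> {0..T}) (\<lambda>s. f (y s)) (\<lambda>s. differential_comp \<A> f (y s) (y' s))"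
    by (rule controlled_mono)
  then show "\<exists>d>0. controlled (ball r d \<inter> {0..T}) (\<lambda>s. f (y s)) (\<lambda>s. differential_comp \<A> f (y s) (y' s))"
    using d(1) half_gt_zero by blast
qed (use assms(1) in auto)

text \<open>Multiplied by \<open>\<psi>\<close>, each coordinate extends by zero to the manifold.
  Where \<open>\<psi>\<close> is 1, the extension has the value and the differential of the
  coordinate, so for times near \<open>r\<close> its estimates are those of the chart.\<close>

lemma controlled_in_chart:
  assumes fs: "\<And>f. f \<in> smooth_functions \<A> \<Longrightarrow>
      controlled {0..T} (\<lambda>s. f (y s)) (\<lambda>s. differential_comp \<A> f (y s) (y' s))"
    and c: "c \<in> \<A>" and ab: "0 \<le> a" "a \<le> b" "b \<le> T" and yD: "y ` {a..b} \<subseteq> dom_chart c"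
  shows "controlled {a..b} (\<lambda>s. map_chart c (y s)) (\<lambda>s. differential_comp \<A> (map_chart c) (y s) (y' s))"
proof (rule controlled_local_imp[OF ab])
  fix r assume "r \<in> {a..b}"
  then have r: "r \<in> {0..T}" "y r \<in> dom_chart c" using ab yD by auto
  let ?U = "map_chart c ` dom_chart c" and ?u = "map_chart c (y r)"
  have "open ?U" using smooth_manifold_chart[OF M c] unfolding topological_chart_def by blast
  then obtain \<rho> where \<rho>: "0 < \<rho>" "cball ?u \<rho> \<subseteq> ?U"
    using r(2) unfolding open_contains_cball by blast
  \<comment> \<open>With half the radius \<open>\<psi>\<close> vanishes outside the ball of radius
    \<open>\<rho>\<close>, and the closed ball serves as the compact set of the extension by
    zero.\<close>
  obtain \<psi> :: "real ^ 'd \<Rightarrow> real" where \<psi>: "smooth_on UNIV \<psi>"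
    "\<And>v. v \<in> ball ?u (\<rho> / 2) \<Longrightarrow> \<psi> v = 1" "\<And>v. v \<notin> ball ?u (2 * (\<rho> / 2)) \<Longrightarrow> \<psi> v = 0"
    by (rule exists_smooth_cutoff[of "\<rho> / 2" ?u]) (use \<rho>(1) in auto)
  define f where "f i q = (if q \<in> dom_chart c then \<psi> (map_chart c q) * map_chart c q $ i else 0)" for i q
  have f: "f i \<in> smooth_functions \<A>" for i
    unfolding f_def
  proof (rule smooth_functions_extension_by_zero[OF M c _ compact_cball \<rho>(2), where G = "\<lambda>u. \<psi> u * u $ i"])
    show "smooth_on UNIV (\<lambda>u. \<psi> u * u $ i)"
      using \<psi>(1) unfolding smooth_on_def
      by (auto intro: bounded_bilinear.Cn_on[OF bounded_bilinear_mult open_UNIV]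
          Cn_on_bounded_linear[OF bounded_linear_vec_nth open_UNIV])
    show "\<psi> u * u $ i = 0" if "u \<notin> cball ?u \<rho>" for u
      using \<psi>(3)[of u] that by auto
  qed
  have f_coord: "(f i \<circ> inv_chart c) u = u $ i" if "u \<in> ball ?u (\<rho> / 2)" for i u
  proof -
    have "u \<in> ?U" using that \<rho> by (auto intro!: subsetD[OF \<rho>(2)])
    then obtain q where "q \<in> dom_chart c" "u = map_chart c q" by blast
    with \<psi>(2)[OF that] show ?thesis
      by (simp add: f_def inv_chart_map_chart[OF smooth_manifold_chart[OF M c]])
  qed
  have df_coord: "frechet_derivative (f i \<circ> inv_chart c) (at u) v = v $ i"
    if "u \<in> ball ?u (\<rho> / 2)" for i u v
  proof -
    have "((\<lambda>u. u $ i) has_derivative (\<lambda>u. u $ i)) (at u)"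
      by (rule bounded_linear_imp_has_derivative[OF bounded_linear_vec_nth])
    \<comment> \<open>Agreement on an open ball, not only at \<open>u\<close>, carries the
      derivative over.\<close>
    then have "((f i \<circ> inv_chart c) has_derivative (\<lambda>u. u $ i)) (at u)"
      by (rule has_derivative_transform_within_open[OF _ open_ball that]) (simp only: f_coord)
    from fun_cong[OF frechet_derivative_at[OF this], of v] show ?thesis by simp
  qed
  obtain d where d: "0 < d"
    "\<And>s. s \<in> ball r d \<inter> {0..T} \<Longrightarrow> y s \<in> dom_chart c \<and> map_chart c (y s) \<in> ball ?u (\<rho> / 2)"
    by (rule path_stays_in_chart_preimage[OF M yy' c r, of "ball ?u (\<rho> / 2)"]) (use \<rho>(1) in auto)
  have "controlled (ball r d \<inter> {a..b}) (\<lambda>s. map_chart c (y s))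
      (\<lambda>s. differential_comp \<A> (map_chart c) (y s) (y' s))"
  proof (rule controlled_componentwise[where h = "\<lambda>i s. f i (y s)"
        and h' = "\<lambda>i s. differential_comp \<A> (f i) (y s) (y' s)"])
    show "ball r d \<inter> {a..b} \<subseteq> {0..T}" using ab by auto
    then show "controlled (ball r d \<inter> {a..b}) (\<lambda>s. f i (y s)) (\<lambda>s. differential_comp \<A> (f i) (y s) (y' s))" for i
      by (rule controlled_mono[OF fs[OF f]])
    fix i s v assume "s \<in> ball r d \<inter> {a..b}"
    then have s: "s \<in> {0..T}" "y s \<in> dom_chart c" "map_chart c (y s) \<in> ball ?u (\<rho> / 2)"
      using d(2)[of s] ab by auto
    show "f i (y s) = map_chart c (y s) $ i"
      using push_forward_in_chart(1)[OF M yy' f c s(1,2)] f_coord[OF s(3)] by simp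
    show "blinfun_apply (differential_comp \<A> (f i) (y s) (y' s)) v =
        blinfun_apply (differential_comp \<A> (map_chart c) (y s) (y' s)) v $ i"
      using push_forward_in_chart(2)[OF M yy' f c s(1,2)] df_coord[OF s(3)] by simp
  qed
  with d(1) show "\<exists>d>0. controlled (ball r d \<inter> {a..b}) (\<lambda>s. map_chart c (y s))
      (\<lambda>s. differential_comp \<A> (map_chart c) (y s) (y' s))" by blast
qed

end

section \<open>Translation of both memberships into \<open>controlled\<close>\<close>

lemma powr_inverse_squared: "((a::real) powr (1 / p))\<^sup>2 = a powr (2 / p)"
  by (simp add: power2_eq_square flip: powr_add)

theorem theorem2p57:
  fixes T p :: real
    and \<omega> :: "real \<Rightarrow> real \<Rightarrow> real"
    and X :: "(real \<Rightarrow> real ^ 'k) \<times> (real \<Rightarrow> real \<Rightarrow> real ^ 'k ^ 'k)"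
    and M :: "'m topology"
    and \<A> :: "('m, 'd::finite) chart set"
    and y :: "real \<Rightarrow> 'm"
    and y' :: "real \<Rightarrow> real ^ 'k \<Rightarrow> ('m, 'd) tangent"
  assumes "0 < T" and "1 \<le> p" and "p < 3"
    and "control T \<omega>"
    and "weak_geometric_rough_path T p \<omega> X"
    and "smooth_manifold M \<A>"
    and "continuous_manifold_pair T M \<A> (y, y')"
  shows "(y, y') \<in> CRP_manifold T p \<omega> X M \<A> \<longleftrightarrow>
         (\<forall>f \<in> smooth_functions \<A>. push_forward \<A> f (y, y') \<in> CRP T p \<omega> X)"
proof -
  interpret controlled_path T "\<lambda>s t. \<omega> s t powr (1 / p)" "fst X"
    using assms(2,4,5) by (rule controlled_path_rough_path)
  interpret controlled_manifold_path T "\<lambda>s t. \<omega> s t powr (1 / p)" "fst X" M \<A> y y'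
    using assms(6,7) by unfold_locales
  have controlled_iff: "controlled {a..b} z z' \<longleftrightarrow> (\<exists>C\<ge>0. \<forall>s t. a \<le> s \<and> s \<le> t \<and> t \<le> b \<longrightarrow>
      norm (z t - z s - blinfun_apply (z' s) (fst X t - fst X s)) \<le> C * \<omega> s t powr (2 / p) \<and>
      norm (z' t - z' s) \<le> C * \<omega> s t powr (1 / p))"
    for a b and z :: "real \<Rightarrow> 'v::real_normed_vector" and z'
    unfolding controlled_def powr_inverse_squared by (rule ex_cong1) force
  have manifold_iff: "(y, y') \<in> CRP_manifold T p \<omega> X M \<A> \<longleftrightarrow>
      (\<forall>c\<in>\<A>. \<forall>a b. 0 \<le> a \<and> a \<le> b \<and> b \<le> T \<and> y ` {a..b} \<subseteq> dom_chart c \<longrightarrow>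
        controlled {a..b} (\<lambda>s. map_chart c (y s)) (\<lambda>s. differential_comp \<A> (map_chart c) (y s) (y' s)))"
    using assms(7) unfolding CRP_manifold_def Let_def controlled_iff by simp
  have CRP_iff: "push_forward \<A> f (y, y') \<in> CRP T p \<omega> X \<longleftrightarrow>
      controlled {0..T} (\<lambda>s. f (y s)) (\<lambda>s. differential_comp \<A> f (y s) (y' s))"
    if f: "f \<in> smooth_functions \<A>" for f
  proof -
    let ?z = "\<lambda>s. f (y s)" and ?z' = "\<lambda>s. differential_comp \<A> f (y s) (y' s)"
    let ?P = "\<lambda>C. \<forall>s t. 0 \<le> s \<and> s \<le> t \<and> t \<le> T \<longrightarrow>
      norm (?z t - ?z s - blinfun_apply (?z' s) (fst X t - fst X s)) \<le> C * \<omega> s t powr (2 / p) \<and>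
      norm (?z' t - ?z' s) \<le> C * \<omega> s t powr (1 / p)"
    have cont: "continuous_on {0..T} ?z" "continuous_on {0..T} ?z'"
      using continuous_on_push_forward[OF assms(6,7) f] by (auto dest: continuous_on_fst continuous_on_snd)
    \<comment> \<open>\<open>CRP\<close> allows a constant of any sign, \<open>controlled\<close> a
      nonnegative one; powers of \<open>\<omega>\<close> are nonnegative, so
      \<open>\<bar>C\<bar>\<close> works as well.\<close>
    have abs: "?P \<bar>C\<bar>" if "?P C" for C
    proof (intro allI impI conjI)
      fix s t assume "0 \<le> s \<and> s \<le> t \<and> t \<le> T"
      with that have "norm (?z t - ?z s - blinfun_apply (?z' s) (fst X t - fst X s)) \<le> C * \<omega> s t powr (2 / p)"
        "norm (?z' t - ?z' s) \<le> C * \<omega> s t powr (1 / p)" by blast+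
      moreover have "C * \<omega> s t powr e \<le> \<bar>C\<bar> * \<omega> s t powr e" for e
        by (rule mult_right_mono) auto
      ultimately show "norm (?z t - ?z s - blinfun_apply (?z' s) (fst X t - fst X s)) \<le> \<bar>C\<bar> * \<omega> s t powr (2 / p)"
        "norm (?z' t - ?z' s) \<le> \<bar>C\<bar> * \<omega> s t powr (1 / p)" by (blast intro: order_trans)+
    qed
    have "(\<exists>C. ?P C) \<longleftrightarrow> (\<exists>C\<ge>0. ?P C)"
    proof
      assume "\<exists>C. ?P C"
      then obtain C where "?P C" by (rule exE)
      from abs[OF this] show "\<exists>C\<ge>0. ?P C" by (intro exI[of _ "\<bar>C\<bar>"] conjI abs_ge_zero)
    next
      assume "\<exists>C\<ge>0. ?P C"
      then obtain C where "0 \<le> C \<and> ?P C" by (rule exE)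
      then show "\<exists>C. ?P C" by (intro exI[of _ C]) (rule conjunct2)
    qed
    moreover have "push_forward \<A> f (y, y') \<in> CRP T p \<omega> X \<longleftrightarrow> (\<exists>C. ?P C)"
      using cont by (simp add: CRP_def push_forward_def Let_def)
    ultimately show ?thesis unfolding controlled_iff by (rule trans[rotated])
  qed
  show ?thesis
  proof
    assume "(y, y') \<in> CRP_manifold T p \<omega> X M \<A>"
    then show "\<forall>f \<in> smooth_functions \<A>. push_forward \<A> f (y, y') \<in> CRP T p \<omega> X"
      using assms(1) unfolding manifold_iff by (auto simp: CRP_iff intro!: controlled_push_forward)
  next
    assume "\<forall>f \<in> smooth_functions \<A>. push_forward \<A> f (y, y') \<in> CRP T p \<omega> X"
    then show "(y, y') \<in> CRP_manifold T p \<omega> X M \<A>"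
      unfolding manifold_iff by (auto simp: CRP_iff intro!: controlled_in_chart)
  qed
qed

end
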